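(* Let $M$ be a nonzero maximal ideal of a Prüfer domain $R$. Then the only possible values for $\boldsymbol{\Lambda}(M)$ are $\langle \mathbf{S},\mathbf{D},\mathbf{B},\neg\mathbf{I}\rangle$, $\langle \mathbf{S},\neg\mathbf{D},\mathbf{B},\mathbf{I}\rangle$, $\langle \mathbf{S},\neg\mathbf{D},\neg\mathbf{B},\mathbf{I}\rangle$, $\langle \neg\mathbf{S},\neg\mathbf{D},\mathbf{B},\mathbf{I}\rangle$, $\langle \neg\mathbf{S},\neg\mathbf{D},\mathbf{B},\neg\mathbf{I}\rangle$ and $\langle \neg\mathbf{S},\neg\mathbf{D},\neg\mathbf{B},\mathbf{I}\rangle$. More precisely: (1) $\boldsymbol{\Lambda}(M)=\langle \mathbf{S},\mathbf{D},\mathbf{B},\neg\mathbf{I}\rangle$ if and only if $R\subsetneq M^{-1}$ (i.e. $M$ is invertible). (2) The following are equivalent: (2-i) $\boldsymbol{\Lambda}(M)=\langle \mathbf{S},\neg\mathbf{D},\mathbf{B},\mathbf{I}\rangle$. (2-ii) $M$ is not finitely generated, but there is a finitely generated ideal $I$ such that $M=\sqrt I$. (2-iii) $M$ is not locally principal, but $M=\sqrt I$ for some finitely generated ideal $I$. (2-iv) $M$ is not invertible, but there are proper $M$-primary ideals that are divisorial. In this case, $R=M^{-1}=T(M)\subsetneq \Omega(M)\subseteq\Theta(M)$. (3) The following are equivalent: (3-i) $\boldsymbol{\Lambda}(M)=\langle \mathbf{S},\neg\mathbf{D},\neg\mathbf{B},\mathbf{I}\rangle$. (3-ii) $M=\bigcup\{P_\alpha\mid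 P_\alpha\subsetneq M,\ P_\alpha\in \mathrm{Spec}(R)\}$ and $R\subsetneq\Theta(M)$. (3-iii) $M$ has no proper primary ideals and there is a divisorial ideal contained in $M$ and no other maximal ideal. (3-iv) $M$ has no proper primary ideals and there is a finitely generated ideal contained in $M$ and no other maximal ideal. (3-v) $M$ has no proper primary ideals and there is a sharp prime contained in $M$ and no other maximal ideal. In this case, $R=M^{-1}=T(M)=\Omega(M)\subsetneq\Theta(M)$. (4) The following are equivalent: (4-i) $\boldsymbol{\Lambda}(M)=\langle \neg\mathbf{S},\neg\mathbf{D},\mathbf{B},\mathbf{I}\rangle$. (4-ii) $M$ is minimal over a finitely generated ideal, but it is neither the radical of a finitely generated ideal nor locally principal. (4-iii) There are proper $M$-primary ideals, none of these are divisorial, and $M$ is not locally principal. (4-iv) $M$ is the radical of an ideal properly contained in $M$, no $M$-primary ideal is divisorial, and $M$ is not locally principal. In this case, $R=M^{-1}=T(M)=\Omega(M)=\Theta(M)$. (5) The following are equivalent: (5-i) $\boldsymbol{\Lambda}(M)=\langle \neg\mathbf{S},\neg\mathbf{D},\mathbf{B},\neg\mathbf{I}\rangle$. (5-ii) $M$ is locally principal, but it is not the radical of a finitely generated ideal. (5-iii) $M$ is locally principal, but no proper $M$-primary ideal is divisorial. (5-iv) $M$ is the radical of an ideal properly contained in $M$, no $M$-primary ideal is divisorial, and $M$ is locally principal. In this case, $R=M^{-1}=T(M)=\Omega(M)=\Theta(M)$. (6) The following are equivalent: (6-i) $\boldsymbol{\Lambda}(M)=\langle \neg\mathbf{S},\neg\mathbf{D},\neg\mathbf{B},\mathbf{I}\rangle$.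 (6-ii) $M=\bigcup\{P_\alpha\mid P_\alpha\subsetneq M,\ P_\alpha\in \mathrm{Spec}(R)\}$ and $R=\Theta(M)$. (6-iii) $M$ has no proper primary ideals and each finitely generated ideal contained in $M$ is contained in at least one other maximal ideal. (6-iv) $M$ has no proper primary ideals and each divisorial ideal contained in $M$ is contained in at least one other maximal ideal. In this case, $R=M^{-1}=T(M)=\Omega(M)=\Theta(M)$.
   Context: $R$ is an integral domain with quotient field $K\neq R$. For a nonzero ideal $I$ of $R$: $I^{-1}=(R:I)=\{z\in K\mid zI\subseteq R\}$; $I^v=(I^{-1})^{-1}$; $I$ is divisorial if $I=I^v$; $T(I)=\bigcup_{n\ge 0}(R:I^n)$; $\Omega(I)=\{z\in K\mid \text{for each } i\in I,\ z i^{n(i)}\in R \text{ for some } n(i)\in\mathbb Z^+\}$, which equals $\bigcap\{R_Q\mid Q \text{ a prime ideal not containing } I\}$ ($=K$ if every nonzero prime contains $I$); $\Theta(I)=\bigcap\{R_N\mid N \text{ a maximal ideal not containing } I\}$, with $\Theta(I)=K$ if every maximal ideal contains $I$. A nonzero prime $P$ of $R$ is sharp if $R_P$ does not contain $\Theta(P)$. A proper $P$-primary ideal is a $P$-primary ideal different from $P$. $P$ is branched if there exists a proper $P$-primary ideal, and unbranched otherwise. "$M$ has no proper primary ideals" means there is no proper $M$-primary ideal. $P$ is idempotent if $P=P^2$. A maximal ideal $M$ is locally principal if $MR_N$ is a principal ideal of $R_N$ for each maximal ideal $N$ (equivalently, $MR_M$ is principal). For a maximal ideal $M$ of a Prüfer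 domain, $\boldsymbol{\Lambda}(M)$ is the 4-tuple whose entries record, in order: whether $M$ is sharp ($\mathbf S$) or not ($\neg\mathbf S$); divisorial ($\mathbf D$) or not ($\neg\mathbf D$); branched ($\mathbf B$) or not ($\neg\mathbf B$); idempotent ($\mathbf I$) or not ($\neg\mathbf I$). *)

theory Defs
  imports "HOL-Algebra.Algebra"
begin

text \<open>
  An integral domain \<open>R\<close> inside its quotient field \<open>K\<close>.  The ring \<open>R\<close> is a record of its own, so
  that the library's notions of ideal, prime ideal etc. apply to it; the equation \<open>R_eq\<close> says that
  its operations are those of \<open>K\<close>.
\<close>

locale domain_in_quotient_field = R?: domain R + K?: field K
  for R :: "('a, 'b) ring_scheme" (structure) and K :: "('a, 'b) ring_scheme" (structure) +
  assumes subring_R: "subring (carrier R) K"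
    and R_eq: "R = K\<lparr>carrier := carrier R\<rparr>"
    and quotient: "z \<in> carrier K \<Longrightarrow>
      \<exists>a \<in> carrier R. \<exists>b \<in> carrier R - {\<zero>\<^bsub>R\<^esub>}. z = a \<otimes>\<^bsub>K\<^esub> inv\<^bsub>K\<^esub> b"


section \<open>Ideals of a ring\<close>

definition fin_gen_ideal :: "('a, 'b) ring_scheme \<Rightarrow> 'a set \<Rightarrow> bool" where
  "fin_gen_ideal R I \<longleftrightarrow> (\<exists>S \<subseteq> carrier R. finite S \<and> I = Idl\<^bsub>R\<^esub> S)"

primrec ideal_power :: "('a, 'b) ring_scheme \<Rightarrow> 'a set \<Rightarrow> nat \<Rightarrow> 'a set" where
  "ideal_power R I 0 = carrier R"
| "ideal_power R I (Suc n) = ideal_power R I n \<cdot>\<^bsub>R\<^esub> I"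

definition ideal_radical :: "('a, 'b) ring_scheme \<Rightarrow> 'a set \<Rightarrow> 'a set" where
  "ideal_radical R I = {x \<in> carrier R. \<exists>n::nat. 0 < n \<and> x [^]\<^bsub>R\<^esub> n \<in> I}"

definition primary_ideal :: "('a, 'b) ring_scheme \<Rightarrow> 'a set \<Rightarrow> bool" where
  "primary_ideal R Q \<longleftrightarrow> ideal Q R \<and> Q \<noteq> carrier R \<and>
    (\<forall>a \<in> carrier R. \<forall>b \<in> carrier R.
      a \<otimes>\<^bsub>R\<^esub> b \<in> Q \<longrightarrow> a \<in> Q \<or> (\<exists>n::nat. 0 < n \<and> b [^]\<^bsub>R\<^esub> n \<in> Q))"

text \<open>\<open>primary_to R P Q\<close>: the ideal \<open>Q\<close> is \<open>P\<close>-primary.\<close>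

definition primary_to :: "('a, 'b) ring_scheme \<Rightarrow> 'a set \<Rightarrow> 'a set \<Rightarrow> bool" where
  "primary_to R P Q \<longleftrightarrow> primary_ideal R Q \<and> ideal_radical R Q = P"

text \<open>Here ``proper'' means different from \<open>P\<close>, not just different from the whole ring.\<close>

definition proper_primary_to :: "('a, 'b) ring_scheme \<Rightarrow> 'a set \<Rightarrow> 'a set \<Rightarrow> bool" where
  "proper_primary_to R P Q \<longleftrightarrow> primary_to R P Q \<and> Q \<noteq> P"

definition branched :: "('a, 'b) ring_scheme \<Rightarrow> 'a set \<Rightarrow> bool" where
  "branched R P \<longleftrightarrow> (\<exists>Q. proper_primary_to R P Q)"

definition idempotent_ideal :: "('a, 'b) ring_scheme \<Rightarrow> 'a set \<Rightarrow> bool" where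
  "idempotent_ideal R P \<longleftrightarrow> P = P \<cdot>\<^bsub>R\<^esub> P"

definition minimal_prime_over :: "('a, 'b) ring_scheme \<Rightarrow> 'a set \<Rightarrow> 'a set \<Rightarrow> bool" where
  "minimal_prime_over R P I \<longleftrightarrow> primeideal P R \<and> I \<subseteq> P \<and>
    (\<forall>Q. primeideal Q R \<and> I \<subseteq> Q \<and> Q \<subseteq> P \<longrightarrow> Q = P)"

definition in_no_other_maximal :: "('a, 'b) ring_scheme \<Rightarrow> 'a set \<Rightarrow> 'a set \<Rightarrow> bool" where
  "in_no_other_maximal R M I \<longleftrightarrow> I \<subseteq> M \<and> (\<forall>N. maximalideal N R \<and> I \<subseteq> N \<longrightarrow> N = M)"


section \<open>Notions relative to the quotient field\<close>

text \<open>The argument \<open>J\<close> need not be contained in \<open>R\<close>, so that the operation can be iterated.\<close>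

definition colon_inv :: "('a, 'b) ring_scheme \<Rightarrow> ('a, 'b) ring_scheme \<Rightarrow> 'a set \<Rightarrow> 'a set" where
  "colon_inv R K J = {z \<in> carrier K. \<forall>x \<in> J. z \<otimes>\<^bsub>K\<^esub> x \<in> carrier R}"

definition v_closure :: "('a, 'b) ring_scheme \<Rightarrow> ('a, 'b) ring_scheme \<Rightarrow> 'a set \<Rightarrow> 'a set" where
  "v_closure R K I = colon_inv R K (colon_inv R K I)"

definition divisorial :: "('a, 'b) ring_scheme \<Rightarrow> ('a, 'b) ring_scheme \<Rightarrow> 'a set \<Rightarrow> bool" where
  "divisorial R K I \<longleftrightarrow> ideal I R \<and> I \<noteq> {\<zero>\<^bsub>R\<^esub>} \<and> I = v_closure R K I"

text \<open>
  The product is formed in \<open>K\<close>: the library's \<open>ideal_prod K I J\<close> is the set of finite nonempty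
  sums of products \<open>i \<otimes>\<^bsub>K\<^esub> j\<close> for arbitrary subsets \<open>I\<close>, \<open>J\<close> of \<open>K\<close>.
\<close>

definition invertible_ideal :: "('a, 'b) ring_scheme \<Rightarrow> ('a, 'b) ring_scheme \<Rightarrow> 'a set \<Rightarrow> bool" where
  "invertible_ideal R K I \<longleftrightarrow> ideal I R \<and> I \<cdot>\<^bsub>K\<^esub> colon_inv R K I = carrier R"

locale prufer_domain = domain_in_quotient_field +
  assumes fin_gen_invertible:
    "fin_gen_ideal R I \<Longrightarrow> I \<noteq> {\<zero>\<^bsub>R\<^esub>} \<Longrightarrow> invertible_ideal R K I"

text \<open>The localization \<open>R\<^sub>P\<close> at a prime \<open>P\<close>, as a subring of \<open>K\<close>.\<close>

definition loc_at ::
    "('a, 'b) ring_scheme \<Rightarrow> ('a, 'b) ring_scheme \<Rightarrow> 'a set \<Rightarrow> ('a, 'b) ring_scheme" where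
  "loc_at R K P =
    K\<lparr>carrier := {a \<otimes>\<^bsub>K\<^esub> inv\<^bsub>K\<^esub> s | a s. a \<in> carrier R \<and> s \<in> carrier R - P}\<rparr>"

definition locally_principal ::
    "('a, 'b) ring_scheme \<Rightarrow> ('a, 'b) ring_scheme \<Rightarrow> 'a set \<Rightarrow> bool" where
  "locally_principal R K I \<longleftrightarrow>
    (\<forall>N. maximalideal N R \<longrightarrow>
      principalideal (Idl\<^bsub>loc_at R K N\<^esub> I) (loc_at R K N))"

definition ideal_transform ::
    "('a, 'b) ring_scheme \<Rightarrow> ('a, 'b) ring_scheme \<Rightarrow> 'a set \<Rightarrow> 'a set" where
  "ideal_transform R K I = (\<Union>n. colon_inv R K (ideal_power R I n))"

definition Omega_transform ::
    "('a, 'b) ring_scheme \<Rightarrow> ('a, 'b) ring_scheme \<Rightarrow> 'a set \<Rightarrow> 'a set" where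
  "Omega_transform R K I =
    {z \<in> carrier K. \<forall>i \<in> I. \<exists>n::nat. 0 < n \<and> z \<otimes>\<^bsub>K\<^esub> (i [^]\<^bsub>K\<^esub> n) \<in> carrier R}"

text \<open>The empty intersection is \<open>carrier K\<close>, which is the convention wanted here.\<close>

definition Theta_transform ::
    "('a, 'b) ring_scheme \<Rightarrow> ('a, 'b) ring_scheme \<Rightarrow> 'a set \<Rightarrow> 'a set" where
  "Theta_transform R K I =
    {z \<in> carrier K. \<forall>N. maximalideal N R \<and> \<not> I \<subseteq> N \<longrightarrow> z \<in> carrier (loc_at R K N)}"

definition sharp_prime ::
    "('a, 'b) ring_scheme \<Rightarrow> ('a, 'b) ring_scheme \<Rightarrow> 'a set \<Rightarrow> bool" where
  "sharp_prime R K P \<longleftrightarrow> primeideal P R \<and> P \<noteq> {\<zero>\<^bsub>R\<^esub>} \<and>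
    \<not> Theta_transform R K P \<subseteq> carrier (loc_at R K P)"

text \<open>
  The 4-tuple records in order: sharp, divisorial, branched, idempotent.  \<open>True\<close> stands for
  \<open>S, D, B, I\<close> and \<open>False\<close> for the respective negation.
\<close>

definition Lambda_tuple ::
    "('a, 'b) ring_scheme \<Rightarrow> ('a, 'b) ring_scheme \<Rightarrow> 'a set \<Rightarrow> bool \<times> bool \<times> bool \<times> bool" where
  "Lambda_tuple R K M =
    (sharp_prime R K M, divisorial R K M, branched R M, idempotent_ideal R M)"

end

theory Submission
  imports Defs
begin

text \<open>
  Since every \<open>z \<in> K\<close> admits \<open>s\<close>, \<open>t\<close> in its conductor \<open>C(z) = {r \<in> R. r z \<in> R}\<close> with \<open>s + t z = 1\<close>,
  conductors are finitely generated and \<open>R\<^sub>M\<close> is a valuation ring.  The theorem reduces to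
  characterizations of the four entries of the tuple.  \<open>M\<close> is sharp iff some finitely generated
  (equivalently: some divisorial) ideal lies in \<open>M\<close> and in no other maximal ideal, because
  \<open>z \<in> \<Theta>(M)\<close> says that \<open>C(z)\<close> lies in no maximal ideal other than \<open>M\<close>.  \<open>M\<close> is divisorial iff it
  is finitely generated, and iff it is sharp and not idempotent.  \<open>M\<close> is idempotent iff
  \<open>M R\<^sub>M\<close> is not principal.  \<open>M\<close> is branched iff some \<open>m \<in> M\<close> divides in \<open>R\<^sub>M\<close> a power of each
  element of \<open>M\<close>, i.e. lies in no smaller prime.  Sharp and branched together mean that \<open>M\<close> is
  the radical of a finitely generated ideal, which is also the criterion for \<open>R \<noteq> \<Omega>(M)\<close>.
\<close>

section \<open>Ideals of commutative rings\<close>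

text \<open>Branched and idempotent are local properties, decided in the valuation ring at
  \<open>M\<close>; sharp and divisorial depend on how \<open>M\<close> sits among the other maximal
  ideals. The obstacle is to cross between the two. The bridge: if \<open>I\<close> lies in no
  maximal ideal but \<open>M\<close>, then membership in an ideal containing \<open>I\<close> can be
  tested at \<open>M\<close> alone. Sharpness supplies such an \<open>I\<close> that is finitely
  generated, and adjoining one locally suitable element of \<open>M\<close> turns it into a finitely
  generated ideal with radical \<open>M\<close>, or into \<open>M\<close> itself. No valuation and
  no value group appear. Divisibility in the localization is expressed inside \<open>R\<close> with
  denominators cleared, and the totality of this relation carries all local arguments. Apart from
  making finitely generated ideals divisorial, invertibility enters through the equation
  \<open>s + t z = 1\<close>, with \<open>s\<close> and \<open>t\<close> in the conductor of
  \<open>z\<close>; the same equation shows that an idempotent \<open>M\<close> cannot be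
  divisorial.\<close>

lemma (in cring) idealI_cring:
  assumes "I \<subseteq> carrier R" "\<zero> \<in> I"
    and add: "\<And>a b. a \<in> I \<Longrightarrow> b \<in> I \<Longrightarrow> a \<oplus> b \<in> I"
    and mult: "\<And>r a. r \<in> carrier R \<Longrightarrow> a \<in> I \<Longrightarrow> r \<otimes> a \<in> I"
  shows "ideal I R"
proof (rule idealI[OF ring_axioms])
  show "subgroup I (add_monoid R)"
  proof (rule add.subgroupI)
    fix a assume "a \<in> I"
    then have "(\<ominus> \<one>) \<otimes> a \<in> I" "a \<in> carrier R" using mult assms(1) by auto
    then show "\<ominus> a \<in> I" by (simp add: l_minus)
  qed (use assms in auto)
  fix a x assume "a \<in> I" "x \<in> carrier R"
  then show "x \<otimes> a \<in> I" "a \<otimes> x \<in> I"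
    using mult[of x a] assms(1) m_comm[of a x] by auto
qed

lemma maximalideal_properties:
  assumes "maximalideal N R"
  shows "ideal N R" "N \<subseteq> carrier R" "\<one>\<^bsub>R\<^esub> \<notin> N"
    "\<And>J. ideal J R \<Longrightarrow> N \<subseteq> J \<Longrightarrow> J \<noteq> carrier R \<Longrightarrow> J = N"
proof -
  interpret maximalideal N R by fact
  show "ideal N R" "N \<subseteq> carrier R" using is_ideal a_subset by auto
  show "\<one>\<^bsub>R\<^esub> \<notin> N" using one_imp_carrier I_notcarr by auto
  show "J = N" if "ideal J R" "N \<subseteq> J" "J \<noteq> carrier R" for J
    using I_maximal[of J] that ideal.Icarr[OF that(1)] by auto
qed

lemma maximalideal_subset_eq:
  assumes "maximalideal M R" "maximalideal N R" "M \<subseteq> N"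
  shows "N = M"
  using maximalideal.I_maximal[OF assms(1), of N] maximalideal.I_notcarr[OF assms(2)]
    maximalideal_properties(1,2)[OF assms(2)] assms(3) by auto

lemma primeideal_pow:
  assumes P: "primeideal P R" and "x \<in> carrier R" "x [^]\<^bsub>R\<^esub> (n::nat) \<in> P"
  shows "x \<in> P"
proof -
  interpret primeideal P R by fact
  show ?thesis using assms(3)
  proof (induction n)
    case 0
    then show ?case using one_imp_carrier I_notcarr by auto
  next
    case (Suc n)
    then show ?case using I_prime[of "x [^]\<^bsub>R\<^esub> n" x] assms(2) by auto
  qed
qed

lemma (in cring) maximalideal_above:
  assumes "ideal I R" "I \<noteq> carrier R"
  obtains N where "maximalideal N R" "I \<subseteq> N"
proof -
  let ?A = "{J. ideal J R \<and> I \<subseteq> J \<and> \<one> \<notin> J}"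
  have "\<exists>N\<in>?A. \<forall>Y\<in>?A. N \<subseteq> Y \<longrightarrow> Y = N"
  proof (rule subset_Zorn_nonempty)
    show "?A \<noteq> {}" using assms ideal.one_imp_carrier[OF assms(1)] by auto
    fix C assume C: "C \<noteq> {}" "subset.chain ?A C"
    then have chain: "subset.chain {I. ideal I R} C" and CA: "\<And>J. J \<in> C \<Longrightarrow> J \<in> ?A"
      unfolding pred_on.chain_def by blast+
    then have "ideal (\<Union>C) R" using chain_Union_is_ideal[OF chain] C(1) by simp
    moreover have "I \<subseteq> \<Union>C" "\<one> \<notin> \<Union>C" using C(1) CA by blast+
    ultimately show "\<Union>C \<in> ?A" by simp
  qed
  then obtain N where N: "N \<in> ?A" and max: "\<forall>Y\<in>?A. N \<subseteq> Y \<longrightarrow> Y = N" by (rule bexE)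
  have "maximalideal N R"
  proof (rule maximalidealI)
    show "ideal N R" "carrier R \<noteq> N" using N by auto
    fix J assume J: "ideal J R" "N \<subseteq> J" "J \<subseteq> carrier R"
    show "J = N \<or> J = carrier R"
    proof (cases "\<one> \<in> J")
      case True then show ?thesis using ideal.one_imp_carrier[OF J(1)] by auto
    next
      case False then show ?thesis using bspec[OF max, of J] J N by auto
    qed
  qed
  then show ?thesis using that N by auto
qed

lemma (in cring) residual_ideal:
  assumes J: "ideal J R" and x: "x \<in> carrier R"
  shows "ideal {r \<in> carrier R. r \<otimes> x \<in> J} R"
proof -
  interpret J: ideal J R by fact
  show ?thesis
  proof (rule idealI_cring)
    fix r a assume "r \<in> carrier R" "a \<in> {r \<in> carrier R. r \<otimes> x \<in> J}"
    then show "r \<otimes> a \<in> {r \<in> carrier R. r \<otimes> x \<in> J}"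
      using x J.I_l_closed[of "a \<otimes> x" r] by (simp add: m_assoc)
  qed (use x in \<open>auto simp: l_distr\<close>)
qed

text \<open>The residual ideal \<open>(J : x)\<close> is proper unless \<open>x\<close> is in
  \<open>J\<close>, so otherwise some maximal ideal contains it. Since it contains \<open>J\<close>,
  only maximal ideals above \<open>J\<close> need testing; this restriction is what later leaves
  \<open>M\<close> as the only place to look.\<close>

lemma (in cring) mem_ideal_if_locally_mem:
  assumes J: "ideal J R" and x: "x \<in> carrier R"
    and loc: "\<And>N. maximalideal N R \<Longrightarrow> J \<subseteq> N \<Longrightarrow> \<exists>s \<in> carrier R - N. s \<otimes> x \<in> J"
  shows "x \<in> J"
proof (rule ccontr)
  let ?C = "{r \<in> carrier R. r \<otimes> x \<in> J}"
  assume "x \<notin> J"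
  then have "\<one> \<notin> ?C" using x by auto
  then have "?C \<noteq> carrier R" by blast
  then obtain N where N: "maximalideal N R" "?C \<subseteq> N"
    using maximalideal_above[OF residual_ideal[OF J x]] by blast
  have "J \<subseteq> ?C" using x ideal.I_r_closed[OF J] ideal.Icarr[OF J] by auto
  then show False using loc[OF N(1)] N(2) by auto
qed

section \<open>Primary ideals and radicals\<close>

lemma primary_to_ideal: "primary_to R P Q \<Longrightarrow> ideal Q R"
  by (simp add: primary_to_def primary_ideal_def)

text \<open>The form in which primariness is used below: \<open>Q\<close> is contracted from the
  localization at \<open>P\<close>, since a power of \<open>s\<close> in \<open>Q\<close> would put
  \<open>s\<close> into the radical \<open>P\<close>.\<close>

lemma primary_to_cancel:
  assumes Q: "primary_to R P Q"
    and "s \<in> carrier R" "s \<notin> P" "x \<in> carrier R" "x \<otimes>\<^bsub>R\<^esub> s \<in> Q"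
  shows "x \<in> Q"
  using assms unfolding primary_to_def primary_ideal_def ideal_radical_def by blast

lemma (in cring) ideal_radical_mono: "I \<subseteq> J \<Longrightarrow> ideal_radical R I \<subseteq> ideal_radical R J"
  by (auto simp: ideal_radical_def)

lemma (in cring) subset_ideal_radical:
  assumes "ideal I R" shows "I \<subseteq> ideal_radical R I"
proof
  fix x assume "x \<in> I"
  then show "x \<in> ideal_radical R I"
    using ideal.Icarr[OF assms] by (auto simp: ideal_radical_def intro!: exI[of _ 1])
qed

lemma (in cring) ideal_radical_subset_prime:
  assumes "primeideal P R" "I \<subseteq> P" shows "ideal_radical R I \<subseteq> P"
  using primeideal_pow[OF assms(1)] assms(2) by (auto simp: ideal_radical_def)

text \<open>The radical leaves \<open>M\<close> as the only maximal ideal above \<open>Q\<close>,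
  and a factor \<open>b\<close> outside \<open>M\<close> is itself the multiplier that the local
  test at \<open>M\<close> asks for.\<close>

lemma (in cring) primary_to_if_radical_maximal:
  assumes M: "maximalideal M R" and Q: "ideal Q R" and rad: "ideal_radical R Q = M"
  shows "primary_to R M Q"
proof -
  note maxM = maximalideal_properties[OF M]
  have only: "N = M" if "maximalideal N R" "Q \<subseteq> N" for N
    using ideal_radical_subset_prime[OF maximalideal_prime[OF that(1)] that(2)] rad
      maximalideal_properties[OF that(1)] maxM(4)[of N] by auto
  have "a \<in> Q \<or> (\<exists>n::nat. 0 < n \<and> b [^] n \<in> Q)"
    if ab: "a \<in> carrier R" "b \<in> carrier R" "a \<otimes> b \<in> Q" for a b
  proof (cases "b \<in> M")
    case True then show ?thesis using rad by (auto simp: ideal_radical_def)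
  next
    case False
    have "a \<in> Q"
      by (rule mem_ideal_if_locally_mem[OF Q ab(1)])
        (use only ab False m_comm[of a b] in force)
    then show ?thesis ..
  qed
  moreover have "Q \<noteq> carrier R" using subset_ideal_radical[OF Q] rad maxM(3) by auto
  ultimately show ?thesis using Q rad by (simp add: primary_to_def primary_ideal_def)
qed

lemma (in cring) only_maximal_if_radical:
  assumes M: "maximalideal M R" and rad: "ideal_radical R Q = M" and Q: "ideal Q R"
  shows "in_no_other_maximal R M Q"
  unfolding in_no_other_maximal_def
proof (intro conjI allI impI)
  show "Q \<subseteq> M" using subset_ideal_radical[OF Q] rad by simp
  fix N assume N: "maximalideal N R \<and> Q \<subseteq> N"
  then show "N = M"
    using ideal_radical_subset_prime[of N Q] maximalideal_prime[of N] rad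
      maximalideal_properties[of N R] maximalideal_properties(4)[OF M, of N] by auto
qed

section \<open>Finitely generated ideals\<close>

lemma (in cring) fin_gen_ideal_is_ideal: "fin_gen_ideal R I \<Longrightarrow> ideal I R"
  by (auto simp: fin_gen_ideal_def genideal_ideal)

lemma (in cring) fin_gen_ideal_principal: "a \<in> carrier R \<Longrightarrow> fin_gen_ideal R (Idl {a})"
  unfolding fin_gen_ideal_def by (rule exI[of _ "{a}"]) auto

lemma (in cring) mem_Idl_singleton:
  assumes "a \<in> carrier R" shows "x \<in> Idl {a} \<longleftrightarrow> (\<exists>r \<in> carrier R. x = r \<otimes> a)"
  using cgenideal_eq_genideal[OF assms] by (auto simp: cgenideal_def)

text \<open>The minimality clause keeps the enlarged ideal inside \<open>M\<close>: the applications
  need an ideal that is finitely generated, contains a chosen element of \<open>M\<close>, and still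
  lies in \<open>M\<close>.\<close>

lemma (in cring) fin_gen_ideal_insert:
  assumes I: "fin_gen_ideal R I" and a: "a \<in> carrier R"
  obtains J where "fin_gen_ideal R J" "I \<subseteq> J" "a \<in> J"
    "\<And>L. ideal L R \<Longrightarrow> I \<subseteq> L \<Longrightarrow> a \<in> L \<Longrightarrow> J \<subseteq> L"
proof -
  obtain S where S: "S \<subseteq> carrier R" "finite S" "I = Idl S" using I by (auto simp: fin_gen_ideal_def)
  have c: "insert a S \<subseteq> carrier R" using S a by auto
  show ?thesis
  proof
    show "fin_gen_ideal R (Idl (insert a S))" using S c unfolding fin_gen_ideal_def by blast
    show "I \<subseteq> Idl (insert a S)" using subset_Idl_subset[OF c] S by auto
    show "a \<in> Idl (insert a S)" using genideal_self[OF c] by auto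
    fix L assume "ideal L R" "I \<subseteq> L" "a \<in> L"
    then show "Idl (insert a S) \<subseteq> L"
      using genideal_minimal[of L "insert a S"] genideal_self[OF S(1)] S(3) by auto
  qed
qed

text \<open>Residual ideals are used once for each factor to pass from generators to arbitrary
  elements, so no double sum has to be handled. The purpose is the square of \<open>M\<close> when
  \<open>M\<close> is itself finitely generated.\<close>

lemma (in cring) fin_gen_ideal_prod:
  assumes "fin_gen_ideal R I" "fin_gen_ideal R J"
  shows "fin_gen_ideal R (I \<cdot> J)"
proof -
  obtain S T where S: "S \<subseteq> carrier R" "finite S" "I = Idl S"
    and T: "T \<subseteq> carrier R" "finite T" "J = Idl T"
    using assms by (auto simp: fin_gen_ideal_def)
  let ?U = "(\<lambda>(s, t). s \<otimes> t) ` (S \<times> T)"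
  have Ii: "ideal I R" and Ji: "ideal J R" using assms fin_gen_ideal_is_ideal by auto
  have Uc: "?U \<subseteq> carrier R" using S T by auto
  note Ui = genideal_ideal[OF Uc]
  have sj: "s \<otimes> j \<in> Idl ?U" if s: "s \<in> S" and j: "j \<in> J" for s j
  proof -
    have sc: "s \<in> carrier R" using s S by auto
    have "t \<otimes> s \<in> Idl ?U" if "t \<in> T" for t
      using genideal_self[OF Uc] that s m_comm[of t s] T sc by force
    then have "Idl T \<subseteq> {r \<in> carrier R. r \<otimes> s \<in> Idl ?U}"
      using T by (intro genideal_minimal residual_ideal[OF Ui sc]) auto
    then show ?thesis using j T(3) m_comm[of s j] sc by auto
  qed
  have ij: "i \<otimes> j \<in> Idl ?U" if i: "i \<in> I" and j: "j \<in> J" for i j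
  proof -
    have "Idl S \<subseteq> {r \<in> carrier R. r \<otimes> j \<in> Idl ?U}"
      using S sj j by (intro genideal_minimal residual_ideal[OF Ui ideal.Icarr[OF Ji j]]) auto
    then show ?thesis using i S(3) by auto
  qed
  have "x \<in> Idl ?U" if "x \<in> I \<cdot> J" for x
    using that ij additive_subgroup.a_closed[OF ideal.axioms(1)[OF Ui]]
    by (induction x rule: ideal_prod.induct) auto
  moreover have "?U \<subseteq> I \<cdot> J"
    using genideal_self[OF S(1)] genideal_self[OF T(1)] S(3) T(3)
    by (auto intro!: ideal_prod.prod)
  then have "Idl ?U \<subseteq> I \<cdot> J" by (rule genideal_minimal[OF ideal_prod_is_ideal[OF Ii Ji]])
  ultimately have "I \<cdot> J = Idl ?U" by blast
  moreover have "finite ?U" using S T by simp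
  ultimately show ?thesis using Uc unfolding fin_gen_ideal_def by blast
qed

lemma (in cring) Idl_pair_subset:
  assumes a: "a \<in> carrier R" and b: "b \<in> carrier R"
  shows "Idl {a, b} \<subseteq> {r \<otimes> a \<oplus> q \<otimes> b | r q. r \<in> carrier R \<and> q \<in> carrier R}" (is "_ \<subseteq> ?E")
proof (rule genideal_minimal)
  have E: "r \<otimes> a \<oplus> q \<otimes> b \<in> ?E" if "r \<in> carrier R" "q \<in> carrier R" for r q using that by blast
  show "ideal ?E R"
  proof (rule idealI_cring)
    show "\<zero> \<in> ?E" using E[of \<zero> \<zero>] a b by simp
  next
    fix x y assume "x \<in> ?E" "y \<in> ?E"
    then obtain r q r' q' where x: "x = r \<otimes> a \<oplus> q \<otimes> b" "r \<in> carrier R" "q \<in> carrier R"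
      and y: "y = r' \<otimes> a \<oplus> q' \<otimes> b" "r' \<in> carrier R" "q' \<in> carrier R" by blast
    have "x \<oplus> y = (r \<oplus> r') \<otimes> a \<oplus> (q \<oplus> q') \<otimes> b" unfolding x(1) y(1) using x(2,3) y(2,3) a b by algebra
    then show "x \<oplus> y \<in> ?E" using E[of "r \<oplus> r'" "q \<oplus> q'"] x(2,3) y(2,3) by simp
  next
    fix p x assume p: "p \<in> carrier R" and "x \<in> ?E"
    then obtain r q where x: "x = r \<otimes> a \<oplus> q \<otimes> b" "r \<in> carrier R" "q \<in> carrier R" by blast
    have "p \<otimes> x = (p \<otimes> r) \<otimes> a \<oplus> (p \<otimes> q) \<otimes> b" unfolding x(1) using x(2,3) a b p by algebra
    then show "p \<otimes> x \<in> ?E" using E[of "p \<otimes> r" "p \<otimes> q"] x(2,3) p by simp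
  qed (use a b in auto)
  have "a = \<one> \<otimes> a \<oplus> \<zero> \<otimes> b" "b = \<zero> \<otimes> a \<oplus> \<one> \<otimes> b" using a b by simp_all
  then show "{a, b} \<subseteq> ?E" using E[of \<one> \<zero>] E[of \<zero> \<one>] by auto
qed


section \<open>Divisibility in the localization at a maximal ideal\<close>

text \<open>In a domain with \<open>M\<close> maximal this says that \<open>x\<close> lies in the
  principal ideal of \<open>a\<close> in the localization at \<open>M\<close>. Clearing denominators
  keeps the relation inside \<open>R\<close>, so the whole section works without a quotient
  field.\<close>

definition locally_divides :: "('a, 'b) ring_scheme \<Rightarrow> 'a set \<Rightarrow> 'a \<Rightarrow> 'a \<Rightarrow> bool" where
  "locally_divides R M a x \<longleftrightarrow>
    (\<exists>s \<in> carrier R - M. \<exists>r \<in> carrier R. s \<otimes>\<^bsub>R\<^esub> x = r \<otimes>\<^bsub>R\<^esub> a)"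

text \<open>The assumption \<open>total\<close> says that the localization at \<open>M\<close> is a valuation ring.\<close>

locale locally_valuation = domain R for R (structure) +
  fixes M
  assumes maximal: "maximalideal M R" and nonzero: "M \<noteq> {\<zero>}"
    and total: "\<And>a b. a \<in> carrier R \<Longrightarrow> b \<in> carrier R \<Longrightarrow>
      locally_divides R M a b \<or> locally_divides R M b a"
begin

abbreviation ldvd where "ldvd \<equiv> locally_divides R M"

lemma M_ideal: "ideal M R" and M_carr: "x \<in> M \<Longrightarrow> x \<in> carrier R" and M_one: "\<one> \<notin> M"
  using maximalideal_properties[OF maximal] by auto

lemma M_primeideal: "primeideal M R"
  using maximalideal_prime[OF maximal] .

lemma M_prime: "a \<in> carrier R \<Longrightarrow> b \<in> carrier R \<Longrightarrow> a \<otimes> b \<in> M \<Longrightarrow> a \<in> M \<or> b \<in> M"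
  using primeideal.I_prime[OF M_primeideal] .

lemma M_mult: "r \<in> carrier R \<Longrightarrow> x \<in> M \<Longrightarrow> r \<otimes> x \<in> M"
  using ideal.I_l_closed[OF M_ideal] .

lemma exists_nonzero: "\<exists>m \<in> M. m \<noteq> \<zero>"
  using nonzero additive_subgroup.zero_closed[OF ideal.axioms(1)[OF M_ideal]] by auto

lemma ldvdI: "s \<in> carrier R \<Longrightarrow> s \<notin> M \<Longrightarrow> r \<in> carrier R \<Longrightarrow> s \<otimes> x = r \<otimes> a \<Longrightarrow> ldvd a x"
  by (auto simp: locally_divides_def)

lemma ldvd_mult_right: "r \<in> carrier R \<Longrightarrow> a \<in> carrier R \<Longrightarrow> ldvd a (r \<otimes> a)"
  by (rule ldvdI[of \<one> r]) (auto simp: M_one)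

lemma ldvd_refl: "a \<in> carrier R \<Longrightarrow> ldvd a a"
  using ldvd_mult_right[of \<one> a] by simp

lemma ldvd_mult:
  assumes "a \<in> carrier R" "x \<in> carrier R" "b \<in> carrier R" "y \<in> carrier R" "ldvd a x" "ldvd b y"
  shows "ldvd (a \<otimes> b) (x \<otimes> y)"
proof -
  obtain s r where s: "s \<in> carrier R" "s \<notin> M" "r \<in> carrier R" "s \<otimes> x = r \<otimes> a"
    using assms(5) by (auto simp: locally_divides_def)
  obtain t q where t: "t \<in> carrier R" "t \<notin> M" "q \<in> carrier R" "t \<otimes> y = q \<otimes> b"
    using assms(6) by (auto simp: locally_divides_def)
  have "(s \<otimes> t) \<otimes> (x \<otimes> y) = (s \<otimes> x) \<otimes> (t \<otimes> y)" using s(1,3) t(1,3) assms(1-4) by algebra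
  also have "\<dots> = (r \<otimes> a) \<otimes> (q \<otimes> b)" using s(4) t(4) by simp
  also have "\<dots> = (r \<otimes> q) \<otimes> (a \<otimes> b)" using s(1,3) t(1,3) assms(1-4) by algebra
  finally show ?thesis using s t M_prime[of s t] by (intro ldvdI[of "s \<otimes> t" "r \<otimes> q"]) auto
qed

lemma ldvd_trans:
  assumes "a \<in> carrier R" "x \<in> carrier R" "y \<in> carrier R" "ldvd a x" "ldvd x y"
  shows "ldvd a y"
proof -
  obtain s r where s: "s \<in> carrier R" "s \<notin> M" "r \<in> carrier R" "s \<otimes> x = r \<otimes> a"
    using assms(4) by (auto simp: locally_divides_def)
  obtain t q where t: "t \<in> carrier R" "t \<notin> M" "q \<in> carrier R" "t \<otimes> y = q \<otimes> x"
    using assms(5) by (auto simp: locally_divides_def)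
  have "(s \<otimes> t) \<otimes> y = s \<otimes> (t \<otimes> y)" using s(1,3) t(1,3) assms(1-3) by algebra
  also have "\<dots> = q \<otimes> (s \<otimes> x)" unfolding t(4) using s(1,3) t(1,3) assms(1-3) by algebra
  also have "\<dots> = (q \<otimes> r) \<otimes> a" unfolding s(4) using s(1,3) t(1,3) assms(1-3) by algebra
  finally show ?thesis using s t M_prime[of s t] by (intro ldvdI[of "s \<otimes> t" "q \<otimes> r"]) auto
qed

lemma ldvd_add:
  assumes "a \<in> carrier R" "x \<in> carrier R" "y \<in> carrier R" "ldvd a x" "ldvd a y"
  shows "ldvd a (x \<oplus> y)"
proof -
  obtain s r where s: "s \<in> carrier R" "s \<notin> M" "r \<in> carrier R" "s \<otimes> x = r \<otimes> a"
    using assms(4) by (auto simp: locally_divides_def)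
  obtain t q where t: "t \<in> carrier R" "t \<notin> M" "q \<in> carrier R" "t \<otimes> y = q \<otimes> a"
    using assms(5) by (auto simp: locally_divides_def)
  have "(s \<otimes> t) \<otimes> (x \<oplus> y) = t \<otimes> (s \<otimes> x) \<oplus> s \<otimes> (t \<otimes> y)" using s(1,3) t(1,3) assms by algebra
  also have "\<dots> = (t \<otimes> r \<oplus> s \<otimes> q) \<otimes> a"
    unfolding s(4) t(4) using s(1,3) t(1,3) assms by algebra
  finally show ?thesis
    using s t M_prime[of s t] by (intro ldvdI[of "s \<otimes> t" "t \<otimes> r \<oplus> s \<otimes> q"]) auto
qed

text \<open>The ideal is the contraction to \<open>R\<close> of the principal ideal that
  \<open>a\<close> generates in the localization.\<close>

lemma multiples_ideal:
  assumes "a \<in> carrier R" shows "ideal {x \<in> carrier R. ldvd a x} R"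
proof (rule idealI_cring)
  show "\<zero> \<in> {x \<in> carrier R. ldvd a x}" using ldvd_mult_right[of \<zero> a] assms by simp
  fix r x assume "r \<in> carrier R" "x \<in> {x \<in> carrier R. ldvd a x}"
  then show "r \<otimes> x \<in> {x \<in> carrier R. ldvd a x}"
    using ldvd_trans[of a x "r \<otimes> x"] ldvd_mult_right[of r x] assms by auto
qed (use assms ldvd_add in auto)

lemma ldvd_prime:
  assumes P: "primeideal P R" "P \<subseteq> M" and "a \<in> P" "x \<in> carrier R" "ldvd a x"
  shows "x \<in> P"
proof -
  interpret primeideal P R by fact
  obtain s r where s: "s \<in> carrier R" "s \<notin> M" "r \<in> carrier R" "s \<otimes> x = r \<otimes> a"
    using assms(5) by (auto simp: locally_divides_def)
  then have "s \<otimes> x \<in> P" using I_l_closed[of a r] assms(3) by simp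
  then show ?thesis using I_prime[of s x] s P(2) assms(4) by auto
qed

text \<open>By totality \<open>x\<close> locally divides \<open>a\<close>. The cofactor
  \<open>r\<close> must lie in \<open>M\<close>: outside \<open>M\<close> it would be a local unit,
  and the same equation read backwards would make \<open>a\<close> divide \<open>x\<close>.\<close>

lemma not_ldvd:
  assumes "a \<in> carrier R" "x \<in> carrier R" "\<not> ldvd a x"
  obtains s r where "s \<in> carrier R" "s \<notin> M" "r \<in> M" "s \<otimes> a = r \<otimes> x"
proof -
  obtain s r where s: "s \<in> carrier R" "s \<notin> M" "r \<in> carrier R" "s \<otimes> a = r \<otimes> x"
    using total[of a x] assms by (auto simp: locally_divides_def)
  then have "r \<in> M" using ldvdI[of r s x a] assms by auto
  then show ?thesis using that s by blast
qed

lemma eq_mult_imp_zero: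
  assumes "x \<in> carrier R" "s \<in> carrier R" "s \<notin> M" "r \<in> M" "s \<otimes> x = r \<otimes> x"
  shows "x = \<zero>"
  using assms m_rcancel[of x s r] M_carr by auto

text \<open>Cancelling \<open>x\<close> would leave an element outside \<open>M\<close> equal to a
  multiple of \<open>m\<close>. This makes powers and products with elements of \<open>M\<close>
  strictly smaller locally.\<close>

lemma not_ldvd_mult:
  assumes "x \<in> carrier R" "x \<noteq> \<zero>" "m \<in> M"
  shows "\<not> ldvd (m \<otimes> x) x"
proof
  assume "ldvd (m \<otimes> x) x"
  then obtain s r where s: "s \<in> carrier R" "s \<notin> M" "r \<in> carrier R" "s \<otimes> x = r \<otimes> (m \<otimes> x)"
    by (auto simp: locally_divides_def)
  then have "s \<otimes> x = (r \<otimes> m) \<otimes> x" using m_assoc assms M_carr by simp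
  then show False using eq_mult_imp_zero[of x s "r \<otimes> m"] s assms M_mult[of r m] by blast
qed

text \<open>Divisibility being total, one of finitely many generators divides all the others; the
  empty set of generators is served by zero.\<close>

lemma fin_gen_locally_principal:
  assumes "fin_gen_ideal R I"
  obtains m where "m \<in> I" "\<And>y. y \<in> I \<Longrightarrow> ldvd m y"
proof -
  obtain S where S: "S \<subseteq> carrier R" "finite S" "I = Idl S"
    using assms by (auto simp: fin_gen_ideal_def)
  have "\<exists>m \<in> Idl S. \<forall>y \<in> S. ldvd m y" using S(2,1)
  proof (induction S)
    case empty
    show ?case
      using additive_subgroup.zero_closed[OF ideal.axioms(1)[OF genideal_ideal[of "{}"]]] by auto
  next
    case (insert x S)
    then obtain m where m: "m \<in> Idl S" "\<forall>y \<in> S. ldvd m y" by auto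
    have mc: "m \<in> carrier R" using ideal.Icarr[OF genideal_ideal[of S] m(1)] insert.prems by auto
    show ?case
    proof (cases "ldvd m x")
      case True
      have "m \<in> Idl (insert x S)" using subset_Idl_subset[of "insert x S" S] insert.prems m by auto
      then show ?thesis using m True by auto
    next
      case False
      then have xm: "ldvd x m" using total[of x m] mc insert.prems by auto
      then have "\<forall>y \<in> insert x S. ldvd x y"
        using m ldvd_trans[of x m] ldvd_refl[of x] insert.prems mc by auto
      then show ?thesis using genideal_self[of "insert x S"] insert.prems by auto
    qed
  qed
  then obtain m where m: "m \<in> Idl S" "\<forall>y \<in> S. ldvd m y" by auto
  have mc: "m \<in> carrier R" using ideal.Icarr[OF genideal_ideal[OF S(1)] m(1)] .
  have "Idl S \<subseteq> {x \<in> carrier R. ldvd m x}"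
    using m S(1) by (intro genideal_minimal multiples_ideal mc) auto
  then show ?thesis using that m S(3) by auto
qed

section \<open>Idempotence and branchedness in terms of local divisibility\<close>

lemma square_primary: "primary_to R M (M \<cdot> M)"
proof (rule primary_to_if_radical_maximal[OF maximal ideal_prod_is_ideal[OF M_ideal M_ideal]])
  have "x \<in> ideal_radical R (M \<cdot> M)" if "x \<in> M" for x
    using that M_carr ideal_prod.prod[of x M x M R]
    by (auto simp: ideal_radical_def numeral_2_eq_2 intro!: exI[of _ 2])
  then show "ideal_radical R (M \<cdot> M) = M"
    using ideal_radical_subset_prime[OF M_primeideal] ideal_prod_inter[OF M_ideal M_ideal] by blast
qed

lemma not_idempotent_imp_branched: "\<not> idempotent_ideal R M \<Longrightarrow> branched R M"
  using square_primary by (auto simp: idempotent_ideal_def branched_def proper_primary_to_def)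

text \<open>Any \<open>m\<close> in \<open>M\<close> outside the square works: if it did not divide
  some \<open>x\<close> of \<open>M\<close>, then \<open>s \<otimes> m = r \<otimes> x\<close> with
  both \<open>r\<close> and \<open>x\<close> in \<open>M\<close>, and cancelling \<open>s\<close> in
  the primary ideal \<open>M \<cdot> M\<close> would put \<open>m\<close> there. Conversely, if
  \<open>M\<close> equals its square, a local generator \<open>m\<close> is divisible by
  \<open>m \<otimes> m\<close>, hence zero, and \<open>M\<close> would vanish with it.\<close>

lemma not_idempotent_iff: "\<not> idempotent_ideal R M \<longleftrightarrow> (\<exists>m \<in> M. \<forall>x \<in> M. ldvd m x)"
proof
  assume "\<not> idempotent_ideal R M"
  then obtain m where m: "m \<in> M" "m \<notin> M \<cdot> M"
    using ideal_prod_inter[OF M_ideal M_ideal] by (auto simp: idempotent_ideal_def)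
  have "ldvd m x" if x: "x \<in> M" for x
  proof (rule ccontr)
    assume "\<not> ldvd m x"
    then obtain s r where s: "s \<in> carrier R" "s \<notin> M" "r \<in> M" "s \<otimes> m = r \<otimes> x"
      using not_ldvd[of m x] m x M_carr by blast
    then have "m \<otimes> s \<in> M \<cdot> M" using ideal_prod.prod[of r M x M R] x m M_carr m_comm[of m s] by auto
    then show False using primary_to_cancel[OF square_primary, of s m] s m M_carr by auto
  qed
  then show "\<exists>m \<in> M. \<forall>x \<in> M. ldvd m x" using m by auto
next
  assume "\<exists>m \<in> M. \<forall>x \<in> M. ldvd m x"
  then obtain m where m: "m \<in> M" "\<And>x. x \<in> M \<Longrightarrow> ldvd m x" by auto
  note mc = M_carr[OF m(1)]
  show "\<not> idempotent_ideal R M"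
  proof
    assume "idempotent_ideal R M"
    then have "m \<in> M \<cdot> M" using m(1) unfolding idempotent_ideal_def by (rule subst)
    moreover have "u \<in> carrier R \<and> ldvd (m \<otimes> m) u" if "u \<in> M \<cdot> M" for u
      using that
    proof (induction u rule: ideal_prod.induct)
      case (prod i j)
      then show ?case using ldvd_mult[of m i m j] m M_carr by auto
    next
      case (sum u v)
      then show ?case using ldvd_add[of "m \<otimes> m" u v] mc by auto
    qed
    ultimately have "m = \<zero>" using not_ldvd_mult[of m m] m mc by auto
    then have "x = \<zero>" if "x \<in> M" for x
      using m(2)[OF that] M_carr[OF that] additive_subgroup.zero_closed[OF ideal.axioms(1)[OF M_ideal]]
        integral by (fastforce simp: locally_divides_def)
    then show False using exists_nonzero by auto
  qed
qed

text \<open>In the localization at \<open>M\<close>, the radical of the principal ideal of such an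
  \<open>m\<close> is the maximal ideal. The exponent 0 is allowed but never occurs, because an
  element of \<open>M\<close> does not locally divide \<open>\<one>\<close>.\<close>

definition almost_generator where
  "almost_generator m \<longleftrightarrow> m \<in> M \<and> (\<forall>x \<in> M. \<exists>n::nat. ldvd m (x [^] n))"

text \<open>Every element of \<open>M\<close> outside a proper primary ideal \<open>Q\<close> works.
  A power of \<open>x\<close> lies in \<open>Q\<close>; if \<open>m\<close> did not divide it, it
  would divide \<open>m\<close> locally, and then \<open>m\<close> would be in \<open>Q\<close> as
  well.\<close>

lemma branched_imp_almost_generator:
  assumes "branched R M"
  obtains m where "almost_generator m"
proof -
  obtain Q where Q: "primary_to R M Q" "Q \<noteq> M"
    using assms by (auto simp: branched_def proper_primary_to_def)
  note Qi = primary_to_ideal[OF Q(1)]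
  have rad: "ideal_radical R Q = M" using Q(1) by (simp add: primary_to_def)
  then obtain m where m: "m \<in> M" "m \<notin> Q" using subset_ideal_radical[OF Qi] Q(2) by auto
  have "\<exists>n::nat. ldvd m (x [^] n)" if x: "x \<in> M" for x
  proof -
    obtain n :: nat where n: "x [^] n \<in> Q" using x rad by (auto simp: ideal_radical_def)
    have "ldvd m (x [^] n)"
    proof (rule ccontr)
      assume "\<not> ldvd m (x [^] n)"
      then obtain s r where s: "s \<in> carrier R" "s \<notin> M" "r \<in> M" "s \<otimes> m = r \<otimes> x [^] n"
        using not_ldvd[of m "x [^] n"] m x M_carr nat_pow_closed by metis
      then have "m \<otimes> s \<in> Q"
        using ideal.I_l_closed[OF Qi n, of r] m M_carr m_comm[of m s] by auto
      then show False using primary_to_cancel[OF Q(1), of s m] s m M_carr by auto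
    qed
    then show ?thesis ..
  qed
  then show ?thesis using that m by (auto simp: almost_generator_def)
qed

text \<open>Squaring the almost generator makes the contraction of the principal ideal differ from \<open>M\<close>.\<close>

lemma almost_generator_imp_branched:
  assumes m: "almost_generator m"
  shows "branched R M"
proof -
  have mM: "m \<in> M" and mc: "m \<in> carrier R" using m M_carr by (auto simp: almost_generator_def)
  let ?Q = "{x \<in> carrier R. ldvd (m \<otimes> m) x}"
  have Qi: "ideal ?Q R" using multiples_ideal mc by simp
  have QM: "?Q \<subseteq> M"
    using ldvd_prime[OF M_primeideal _ M_mult[OF mc mM]] by blast
  \<comment> \<open>With \<open>m = \<zero>\<close> every element of \<open>M\<close> would be
    nilpotent. A nonzero \<open>m\<close> is needed so that \<open>m\<close> is not divisible by its
    own square.\<close>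
  have "m \<noteq> \<zero>"
  proof
    assume z: "m = \<zero>"
    obtain x where x: "x \<in> M" "x \<noteq> \<zero>" using exists_nonzero by auto
    then obtain n :: nat where "ldvd m (x [^] n)" using m by (auto simp: almost_generator_def)
    then obtain s where "s \<in> carrier R" "s \<notin> M" "s \<otimes> x [^] n = \<zero>"
      by (auto simp: z locally_divides_def)
    moreover have "s \<noteq> \<zero>" using calculation
      additive_subgroup.zero_closed[OF ideal.axioms(1)[OF M_ideal]] by auto
    ultimately have "x [^] n \<in> {\<zero>}" using integral[of s "x [^] n"] x M_carr by auto
    then show False using primeideal_pow[OF zeroprimeideal, of x n] x M_carr by auto
  qed
  then have "m \<notin> ?Q" using not_ldvd_mult[of m m] mc mM by auto
  then have "?Q \<noteq> M" using mM by auto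
  moreover have "M \<subseteq> ideal_radical R ?Q"
  proof
    fix x assume x: "x \<in> M"
    then obtain n :: nat where n: "ldvd m (x [^] n)" using m by (auto simp: almost_generator_def)
    have "n \<noteq> 0"
      using n ldvd_prime[OF M_primeideal subset_refl mM, of \<one>] M_one by (auto intro!: gr0I)
    moreover have "ldvd (m \<otimes> m) (x [^] (n + n))"
      using ldvd_mult[of m "x [^] n" m "x [^] n"] n mc M_carr[OF x] by (simp add: nat_pow_mult)
    ultimately show "x \<in> ideal_radical R ?Q"
      using M_carr[OF x] by (auto simp: ideal_radical_def intro!: exI[of _ "n + n"])
  qed
  ultimately show ?thesis
    using primary_to_if_radical_maximal[OF maximal Qi]
      ideal_radical_subset_prime[OF M_primeideal QM]
    by (auto simp: branched_def proper_primary_to_def)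
qed

lemma almost_generator_prime:
  assumes "almost_generator m" "primeideal P R" "P \<subseteq> M" "m \<in> P"
  shows "P = M"
proof
  show "M \<subseteq> P"
  proof
    fix x assume x: "x \<in> M"
    then obtain n :: nat where "ldvd m (x [^] n)" using assms(1) by (auto simp: almost_generator_def)
    then have "x [^] n \<in> P" using ldvd_prime[OF assms(2-4)] x M_carr by simp
    then show "x \<in> P" using primeideal_pow[OF assms(2)] x M_carr by blast
  qed
qed fact

text \<open>If no power of \<open>x\<close> is locally divisible by \<open>m\<close>, the prime is the contraction of the
  intersection of the powers of the principal ideal of \<open>x\<close> in the valuation ring.\<close>

lemma prime_below:
  assumes m: "m \<in> M" and nb: "\<not> almost_generator m"
  obtains P where "primeideal P R" "P \<subset> M" "m \<in> P"
proof -
  obtain x where x: "x \<in> M" "\<And>n::nat. \<not> ldvd m (x [^] n)"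
    using nb m by (auto simp: almost_generator_def)
  note xc = M_carr[OF x(1)] and mc = M_carr[OF m]
  let ?P = "\<Inter>n::nat. {y \<in> carrier R. ldvd (x [^] n) y}"
  have x0: "x \<noteq> \<zero>"
  proof
    assume "x = \<zero>"
    then have "x [^] (1::nat) = \<zero> \<otimes> m" using mc by simp
    then show False using x(2)[of 1] ldvd_mult_right[of \<zero> m] mc by simp
  qed
  have pow0: "x [^] n \<noteq> \<zero>" for n :: nat
    using primeideal_pow[OF zeroprimeideal xc] x0 by auto
  \<comment> \<open>The powers of \<open>x\<close> descend strictly. This keeps \<open>x\<close> out
    of \<open>?P\<close>, and primality will fail by exactly this one power.\<close>
  have xP: "\<not> ldvd (x [^] Suc n) (x [^] n)" for n :: nat
    using not_ldvd_mult[of "x [^] n" x] x xc pow0[of n] by (simp add: m_comm)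
  have Pi: "ideal ?P R"
    using multiples_ideal[OF nat_pow_closed[OF xc]] by (intro i_Intersect) auto
  have xnP: "x \<notin> ?P" using xP[of 1] xc by (auto intro!: exI[of _ 2] simp: numeral_2_eq_2)
  have P: "primeideal ?P R"
  proof (rule primeidealI[OF Pi is_cring])
    show "carrier R \<noteq> ?P" using xnP xc by blast
    fix a b assume a: "a \<in> carrier R" and b: "b \<in> carrier R" and ab: "a \<otimes> b \<in> ?P"
    show "a \<in> ?P \<or> b \<in> ?P"
    proof (rule ccontr)
      assume "\<not> (a \<in> ?P \<or> b \<in> ?P)"
      then obtain n k :: nat where "\<not> ldvd (x [^] n) a" "\<not> ldvd (x [^] k) b" using a b by auto
      \<comment> \<open>By totality both factors divide a power of \<open>x\<close>, so the product
        divides the power \<open>n + k\<close>, although lying in \<open>?P\<close> it is divisible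
        by the next one.\<close>
      then have "ldvd a (x [^] n)" "ldvd b (x [^] k)"
        using total[of a "x [^] n"] total[of b "x [^] k"] a b xc by auto
      then have 1: "ldvd (a \<otimes> b) (x [^] (n + k))"
        using ldvd_mult[of a _ b] a b xc by (simp add: nat_pow_mult[symmetric])
      have "ldvd (x [^] Suc (n + k)) (a \<otimes> b)" using ab by blast
      from ldvd_trans[OF _ _ _ this 1] show False using xP[of "n + k"] a b xc by auto
    qed
  qed
  show ?thesis
  proof (rule that[OF P])
    have "?P \<subseteq> {y \<in> carrier R. ldvd (x [^] (1::nat)) y}" by blast
    also have "\<dots> \<subseteq> M" using ldvd_prime[OF M_primeideal _ x(1)] xc by auto
    finally show "?P \<subset> M" using xnP x(1) by blast
    \<comment> \<open>No power of \<open>x\<close> is divisible by \<open>m\<close>, so by totality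
      every one of them divides \<open>m\<close>.\<close>
    show "m \<in> ?P" using total[OF mc nat_pow_closed[OF xc]] x(2) mc by auto
  qed
qed

lemma not_branched_imp_prime_below:
  assumes "\<not> branched R M" "m \<in> M"
  obtains P where "primeideal P R" "P \<subset> M" "m \<in> P"
  using prime_below[OF assms(2)] almost_generator_imp_branched assms(1) by blast

lemma Union_primes_iff: "M = \<Union>{P. P \<subset> M \<and> primeideal P R} \<longleftrightarrow> \<not> branched R M"
proof
  assume U: "M = \<Union>{P. P \<subset> M \<and> primeideal P R}"
  show "\<not> branched R M"
  proof
    assume "branched R M"
    then obtain m where m: "almost_generator m" by (rule branched_imp_almost_generator)
    then have "m \<in> \<Union>{P. P \<subset> M \<and> primeideal P R}" using U by (simp add: almost_generator_def)
    then obtain P where "primeideal P R" "P \<subset> M" "m \<in> P" by blast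
    then show False using almost_generator_prime[OF m, of P] by blast
  qed
next
  assume "\<not> branched R M"
  from not_branched_imp_prime_below[OF this]
  have "M \<subseteq> \<Union>{P. P \<subset> M \<and> primeideal P R}" by blast
  then show "M = \<Union>{P. P \<subset> M \<and> primeideal P R}" by blast
qed

text \<open>A principal ideal suffices in one direction. In the other, a prime inside
  \<open>M\<close> contains \<open>I\<close> as soon as it contains a local generator of
  \<open>I\<close>, so in the unbranched case the smaller prime through that generator contradicts
  minimality.\<close>

lemma branched_iff_minimal_over_fin_gen:
  "branched R M \<longleftrightarrow> (\<exists>I. fin_gen_ideal R I \<and> minimal_prime_over R M I)"
proof
  assume "branched R M"
  then obtain m where m: "almost_generator m" by (rule branched_imp_almost_generator)
  then have mM: "m \<in> M" and mc: "m \<in> carrier R" using M_carr by (auto simp: almost_generator_def)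
  have "minimal_prime_over R M (Idl {m})"
    unfolding minimal_prime_over_def
    using almost_generator_prime[OF m] genideal_self'[OF mc] M_primeideal
      genideal_minimal[OF M_ideal, of "{m}"] mM by blast
  then show "\<exists>I. fin_gen_ideal R I \<and> minimal_prime_over R M I"
    using fin_gen_ideal_principal[OF mc] by auto
next
  assume "\<exists>I. fin_gen_ideal R I \<and> minimal_prime_over R M I"
  then obtain I where I: "fin_gen_ideal R I" and min: "minimal_prime_over R M I" by auto
  then have IM: "I \<subseteq> M" by (simp add: minimal_prime_over_def)
  obtain m where m: "m \<in> I" "\<And>y. y \<in> I \<Longrightarrow> ldvd m y" using fin_gen_locally_principal[OF I] by blast
  show "branched R M"
  proof (rule ccontr)
    assume "\<not> branched R M"
    then obtain P where P: "primeideal P R" "P \<subset> M" "m \<in> P"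
      using not_branched_imp_prime_below m(1) IM by blast
    then have "I \<subseteq> P" using ldvd_prime[OF P(1) _ P(3)] m(2) IM M_carr by blast
    then show False using min P by (auto simp: minimal_prime_over_def)
  qed
qed

lemma branched_iff_radical:
  "branched R M \<longleftrightarrow> (\<exists>I. ideal I R \<and> I \<subset> M \<and> M = ideal_radical R I)"
proof
  assume "branched R M"
  then obtain Q where Q: "primary_to R M Q" "Q \<noteq> M"
    by (auto simp: branched_def proper_primary_to_def)
  then have "M = ideal_radical R Q" by (simp add: primary_to_def)
  then show "\<exists>I. ideal I R \<and> I \<subset> M \<and> M = ideal_radical R I"
    using Q primary_to_ideal[OF Q(1)] subset_ideal_radical[of Q] by auto
next
  assume "\<exists>I. ideal I R \<and> I \<subset> M \<and> M = ideal_radical R I"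
  then show "branched R M"
    using primary_to_if_radical_maximal[OF maximal] by (auto simp: branched_def proper_primary_to_def)
qed

text \<open>The passage from local to global: above an ideal that meets no other maximal ideal,
  every ideal is contracted from the localization at \<open>M\<close>.\<close>

lemma mem_if_only_maximal:
  assumes "ideal J R" "I \<subseteq> J" "in_no_other_maximal R M I"
    and "s \<in> carrier R" "s \<notin> M" "x \<in> carrier R" "s \<otimes> x \<in> J"
  shows "x \<in> J"
proof (rule mem_ideal_if_locally_mem)
  fix N assume "maximalideal N R" "J \<subseteq> N"
  then have "N = M" using assms(2,3) unfolding in_no_other_maximal_def by blast
  then show "\<exists>s\<in>carrier R - N. s \<otimes> x \<in> J" using assms by auto
qed fact+

text \<open>The two ingredients are adjoined to each other: \<open>I\<close> excludes the other
  maximal ideals, and an almost generator makes the radical right at \<open>M\<close>.\<close>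

lemma branched_imp_radical_fin_gen:
  assumes "branched R M" and I: "fin_gen_ideal R I" and only: "in_no_other_maximal R M I"
  obtains J where "fin_gen_ideal R J" "M = ideal_radical R J"
proof -
  obtain m where m: "almost_generator m" using branched_imp_almost_generator[OF assms(1)] .
  then have mM: "m \<in> M" and mc: "m \<in> carrier R" using M_carr by (auto simp: almost_generator_def)
  obtain J where J: "fin_gen_ideal R J" "I \<subseteq> J" "m \<in> J" "J \<subseteq> M"
    using fin_gen_ideal_insert[OF I mc] only mM M_ideal unfolding in_no_other_maximal_def by metis
  note Ji = fin_gen_ideal_is_ideal[OF J(1)]
  have "M \<subseteq> ideal_radical R J"
  proof
    fix x assume x: "x \<in> M"
    note xc = M_carr[OF x]
    obtain n :: nat where n: "ldvd m (x [^] n)" using m x by (auto simp: almost_generator_def)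
    then obtain s r where s: "s \<in> carrier R" "s \<notin> M" "r \<in> carrier R" "s \<otimes> x [^] n = r \<otimes> m"
      by (auto simp: locally_divides_def)
    then have "s \<otimes> x [^] n \<in> J" using ideal.I_l_closed[OF Ji J(3)] by simp
    then have "x [^] n \<in> J" using mem_if_only_maximal[OF Ji J(2) only s(1,2)] xc by simp
    moreover have "n \<noteq> 0" using calculation J(4) M_one by (metis nat_pow_0 subsetD)
    ultimately show "x \<in> ideal_radical R J" using xc by (auto simp: ideal_radical_def)
  qed
  then show ?thesis using that[OF J(1)] ideal_radical_subset_prime[OF M_primeideal J(4)] by auto
qed

text \<open>A local generator adjoined to \<open>I\<close> gives an ideal inside \<open>M\<close>
  that agrees with \<open>M\<close> locally, and since \<open>I\<close> excludes all other maximal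
  ideals, it agrees with \<open>M\<close> globally.\<close>

lemma not_idempotent_imp_fin_gen:
  assumes "\<not> idempotent_ideal R M" and I: "fin_gen_ideal R I" and only: "in_no_other_maximal R M I"
  shows "fin_gen_ideal R M"
proof -
  obtain m where m: "m \<in> M" "\<And>x. x \<in> M \<Longrightarrow> ldvd m x" using assms(1) not_idempotent_iff by auto
  obtain J where J: "fin_gen_ideal R J" "I \<subseteq> J" "m \<in> J" "J \<subseteq> M"
    using fin_gen_ideal_insert[OF I M_carr[OF m(1)]] only m(1) M_ideal
    unfolding in_no_other_maximal_def by metis
  note Ji = fin_gen_ideal_is_ideal[OF J(1)]
  have "x \<in> J" if x: "x \<in> M" for x
  proof -
    obtain s r where s: "s \<in> carrier R" "s \<notin> M" "r \<in> carrier R" "s \<otimes> x = r \<otimes> m"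
      using m(2)[OF x] by (auto simp: locally_divides_def)
    then have "s \<otimes> x \<in> J" using ideal.I_l_closed[OF Ji J(3)] by simp
    then show ?thesis using mem_if_only_maximal[OF Ji J(2) only s(1,2)] M_carr[OF x] by simp
  qed
  then show ?thesis using J by (metis subsetI subset_antisym)
qed

end


section \<open>Conductors\<close>

text \<open>The ideal of denominators of \<open>z\<close>. It turns statements about overrings into
  statements about ideals of \<open>R\<close>, and it is itself the finitely generated ideal that
  several of the equivalences ask for.\<close>

definition conductor :: "('a, 'b) ring_scheme \<Rightarrow> ('a, 'b) ring_scheme \<Rightarrow> 'a \<Rightarrow> 'a set" where
  "conductor R K z = {r \<in> carrier R. r \<otimes>\<^bsub>K\<^esub> z \<in> carrier R}"

context domain_in_quotient_field
begin

section \<open>Arithmetic of \<open>R\<close> rewritten into \<open>K\<close>\<close>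

lemma R_mult: "x \<otimes>\<^bsub>R\<^esub> y = x \<otimes>\<^bsub>K\<^esub> y"
  and R_add: "x \<oplus>\<^bsub>R\<^esub> y = x \<oplus>\<^bsub>K\<^esub> y"
  and R_one: "\<one>\<^bsub>R\<^esub> = \<one>\<^bsub>K\<^esub>"
  and R_zero: "\<zero>\<^bsub>R\<^esub> = \<zero>\<^bsub>K\<^esub>"
  by (subst R_eq, simp)+

lemma R_pow: "x [^]\<^bsub>R\<^esub> (n::nat) = x [^]\<^bsub>K\<^esub> n"
  by (induction n) (simp_all add: R_mult R_one)

lemmas R_ops = R_mult R_add R_one R_zero R_pow

lemma R_sub: "x \<in> carrier R \<Longrightarrow> x \<in> carrier K"
  using subringE(1)[OF subring_R] by auto

lemma R_closed [simp]:
  "x \<in> carrier R \<Longrightarrow> y \<in> carrier R \<Longrightarrow> x \<otimes>\<^bsub>K\<^esub> y \<in> carrier R"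
  "x \<in> carrier R \<Longrightarrow> y \<in> carrier R \<Longrightarrow> x \<oplus>\<^bsub>K\<^esub> y \<in> carrier R"
  "x \<in> carrier R \<Longrightarrow> x [^]\<^bsub>K\<^esub> (n::nat) \<in> carrier R"
  "\<one>\<^bsub>K\<^esub> \<in> carrier R" "\<zero>\<^bsub>K\<^esub> \<in> carrier R"
  using R.m_closed[of x y] R.a_closed[of x y] R.nat_pow_closed[of x n] R.one_closed R.zero_closed
  by (simp_all only: R_ops)

lemma R_a_inv_closed: "x \<in> carrier R \<Longrightarrow> \<ominus>\<^bsub>K\<^esub> x \<in> carrier R"
  using subringE(5)[OF subring_R] .

lemma K_inv:
  assumes "x \<in> carrier K" "x \<noteq> \<zero>\<^bsub>K\<^esub>"
  shows "inv\<^bsub>K\<^esub> x \<in> carrier K" "inv\<^bsub>K\<^esub> x \<otimes>\<^bsub>K\<^esub> x = \<one>\<^bsub>K\<^esub>" "x \<otimes>\<^bsub>K\<^esub> inv\<^bsub>K\<^esub> x = \<one>\<^bsub>K\<^esub>"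
  using assms K.field_Units by (auto intro: K.Units_inv_closed K.Units_l_inv K.Units_r_inv)

lemma ideal_K:
  assumes "ideal I R"
  shows "\<And>x. x \<in> I \<Longrightarrow> x \<in> carrier R"
    "\<zero>\<^bsub>K\<^esub> \<in> I"
    "\<And>x y. x \<in> I \<Longrightarrow> y \<in> I \<Longrightarrow> x \<oplus>\<^bsub>K\<^esub> y \<in> I"
    "\<And>r x. r \<in> carrier R \<Longrightarrow> x \<in> I \<Longrightarrow> r \<otimes>\<^bsub>K\<^esub> x \<in> I"
    "\<And>r x. r \<in> carrier R \<Longrightarrow> x \<in> I \<Longrightarrow> x \<otimes>\<^bsub>K\<^esub> r \<in> I"
proof -
  interpret ideal I R by fact
  show "\<And>x. x \<in> I \<Longrightarrow> x \<in> carrier R" by (rule Icarr)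
  show "\<zero>\<^bsub>K\<^esub> \<in> I" using zero_closed by (simp add: R_ops)
  show "\<And>x y. x \<in> I \<Longrightarrow> y \<in> I \<Longrightarrow> x \<oplus>\<^bsub>K\<^esub> y \<in> I" using a_closed by (simp add: R_ops)
  show "\<And>r x. r \<in> carrier R \<Longrightarrow> x \<in> I \<Longrightarrow> r \<otimes>\<^bsub>K\<^esub> x \<in> I" using I_l_closed by (simp add: R_ops)
  show "\<And>r x. r \<in> carrier R \<Longrightarrow> x \<in> I \<Longrightarrow> x \<otimes>\<^bsub>K\<^esub> r \<in> I" using I_r_closed by (simp add: R_ops)
qed

lemma maximal_K:
  assumes "maximalideal N R"
  shows "ideal N R" "\<one>\<^bsub>K\<^esub> \<notin> N" "\<zero>\<^bsub>K\<^esub> \<in> N"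
    "\<And>x. x \<in> N \<Longrightarrow> x \<in> carrier R"
    "\<And>x y. x \<in> carrier R \<Longrightarrow> y \<in> carrier R \<Longrightarrow> x \<otimes>\<^bsub>K\<^esub> y \<in> N \<Longrightarrow> x \<in> N \<or> y \<in> N"
  using maximalideal_properties[OF assms] ideal_K[of N]
    primeideal.I_prime[OF R.maximalideal_prime[OF assms]] by (auto simp: R_ops)

lemma ideal_proper: "ideal I R \<Longrightarrow> \<one>\<^bsub>K\<^esub> \<in> I \<Longrightarrow> I = carrier R"
  using ideal.one_imp_carrier[of I R] by (simp add: R_ops)

section \<open>Conductors and membership in localizations\<close>

lemma conductor_ideal:
  assumes z: "z \<in> carrier K" shows "ideal (conductor R K z) R"
proof (rule R.idealI_cring)
  fix a b assume "a \<in> conductor R K z" "b \<in> conductor R K z"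
  then show "a \<oplus>\<^bsub>R\<^esub> b \<in> conductor R K z"
    using z by (simp add: conductor_def R_ops K.l_distr R_sub)
next
  fix r a assume "r \<in> carrier R" "a \<in> conductor R K z"
  then show "r \<otimes>\<^bsub>R\<^esub> a \<in> conductor R K z"
    using z by (simp add: conductor_def R_ops K.m_assoc R_sub)
qed (use z in \<open>auto simp: conductor_def R_ops\<close>)

lemma conductor_nonzero:
  assumes "z \<in> carrier K"
  obtains b where "b \<in> conductor R K z" "b \<noteq> \<zero>\<^bsub>K\<^esub>"
proof -
  obtain a b where ab: "a \<in> carrier R" "b \<in> carrier R" "b \<noteq> \<zero>\<^bsub>K\<^esub>" "z = a \<otimes>\<^bsub>K\<^esub> inv\<^bsub>K\<^esub> b"
    using quotient[OF assms] by (auto simp: R_ops)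
  have "b \<otimes>\<^bsub>K\<^esub> z = a"
    unfolding ab(4) using K_inv[OF R_sub[OF ab(2)] ab(3)] R_sub[OF ab(1)] R_sub[OF ab(2)]
    by (simp add: K.m_lcomm)
  then show ?thesis using that[of b] ab by (auto simp: conductor_def)
qed

lemma one_mem_conductor: "z \<in> carrier K \<Longrightarrow> \<one>\<^bsub>K\<^esub> \<in> conductor R K z \<longleftrightarrow> z \<in> carrier R"
  by (simp add: conductor_def)

lemma conductor_eq_carrier:
  assumes "z \<in> carrier K"
  shows "conductor R K z = carrier R \<longleftrightarrow> z \<in> carrier R"
  using one_mem_conductor[OF assms] ideal_proper[OF conductor_ideal[OF assms]] R_closed(4) by metis

lemma mem_loc_at:
  assumes N: "maximalideal N R"
  shows "z \<in> carrier (loc_at R K N) \<longleftrightarrow> z \<in> carrier K \<and> (\<exists>s \<in> carrier R - N. s \<otimes>\<^bsub>K\<^esub> z \<in> carrier R)"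
proof
  assume "z \<in> carrier (loc_at R K N)"
  then obtain a s where as: "a \<in> carrier R" "s \<in> carrier R" "s \<notin> N" "z = a \<otimes>\<^bsub>K\<^esub> inv\<^bsub>K\<^esub> s"
    by (auto simp: loc_at_def)
  then have "s \<noteq> \<zero>\<^bsub>K\<^esub>" using maximal_K(3)[OF N] by auto
  note inv = K_inv[OF R_sub[OF as(2)] this]
  have "s \<otimes>\<^bsub>K\<^esub> z = a" unfolding as(4) using inv as by (simp add: K.m_lcomm R_sub)
  then show "z \<in> carrier K \<and> (\<exists>s \<in> carrier R - N. s \<otimes>\<^bsub>K\<^esub> z \<in> carrier R)"
    using as(1-3) inv(1) unfolding as(4) by (intro conjI bexI[of _ s]) (auto simp: R_sub)
next
  assume "z \<in> carrier K \<and> (\<exists>s \<in> carrier R - N. s \<otimes>\<^bsub>K\<^esub> z \<in> carrier R)"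
  then obtain s where z: "z \<in> carrier K" and s: "s \<in> carrier R" "s \<notin> N" "s \<otimes>\<^bsub>K\<^esub> z \<in> carrier R" by auto
  then have "s \<noteq> \<zero>\<^bsub>K\<^esub>" using maximal_K(3)[OF N] by auto
  note inv = K_inv[OF R_sub[OF s(1)] this]
  have "(s \<otimes>\<^bsub>K\<^esub> z) \<otimes>\<^bsub>K\<^esub> inv\<^bsub>K\<^esub> s = z \<otimes>\<^bsub>K\<^esub> (s \<otimes>\<^bsub>K\<^esub> inv\<^bsub>K\<^esub> s)"
    using z s inv(1) by (simp add: K.m_ac R_sub)
  then have "z = (s \<otimes>\<^bsub>K\<^esub> z) \<otimes>\<^bsub>K\<^esub> inv\<^bsub>K\<^esub> s" using inv z by simp
  then show "z \<in> carrier (loc_at R K N)" using s by (auto simp: loc_at_def)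
qed

lemma mem_loc_at_iff_conductor:
  assumes "maximalideal N R" "z \<in> carrier K"
  shows "z \<in> carrier (loc_at R K N) \<longleftrightarrow> \<not> conductor R K z \<subseteq> N"
  using assms by (auto simp: mem_loc_at conductor_def)

lemma mem_Theta:
  "z \<in> Theta_transform R K I \<longleftrightarrow>
    z \<in> carrier K \<and> (\<forall>N. maximalideal N R \<longrightarrow> conductor R K z \<subseteq> N \<longrightarrow> I \<subseteq> N)"
  unfolding Theta_transform_def using mem_loc_at_iff_conductor by blast

lemma conductor_proper_maximal:
  assumes "z \<in> carrier K" "z \<notin> carrier R"
  obtains N where "maximalideal N R" "conductor R K z \<subseteq> N"
  using R.maximalideal_above[OF conductor_ideal[OF assms(1)]] one_mem_conductor[OF assms(1)] assms(2)
    R_closed(4) by metis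

lemma mem_conductor:
  "z \<in> carrier K \<Longrightarrow> x \<in> carrier R \<Longrightarrow> x \<in> conductor R K z \<longleftrightarrow> z \<otimes>\<^bsub>K\<^esub> x \<in> carrier R"
  using K.m_comm[of z x] by (simp add: conductor_def R_sub)

text \<open>The exponent that depends on \<open>i\<close> is exactly the one in the radical of the
  conductor: \<open>z\<close> multiplies a power of \<open>i\<close> into \<open>R\<close> iff that
  power is a denominator of \<open>z\<close>.\<close>

lemma mem_Omega:
  assumes I: "I \<subseteq> carrier R"
  shows "z \<in> Omega_transform R K I \<longleftrightarrow>
    z \<in> carrier K \<and> I \<subseteq> ideal_radical R (conductor R K z)"
proof -
  have "i \<in> ideal_radical R (conductor R K z) \<longleftrightarrow>
      (\<exists>n::nat. 0 < n \<and> z \<otimes>\<^bsub>K\<^esub> i [^]\<^bsub>K\<^esub> n \<in> carrier R)" if "i \<in> I" "z \<in> carrier K" for i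
  proof -
    have i: "i \<in> carrier R" using that I by auto
    show ?thesis
      unfolding ideal_radical_def R_pow using i mem_conductor[OF that(2) R_closed(3)[OF i]] by simp
  qed
  then show ?thesis unfolding Omega_transform_def by blast
qed

section \<open>The chain of transforms\<close>

lemma carrier_subset_transform: "carrier R \<subseteq> ideal_transform R K I"
proof
  fix z assume "z \<in> carrier R"
  then have "z \<in> colon_inv R K (ideal_power R I 0)" by (auto simp: colon_inv_def R_sub)
  then show "z \<in> ideal_transform R K I" unfolding ideal_transform_def by blast
qed

lemma pow_mem_ideal_power:
  assumes "ideal I R" "i \<in> I"
  shows "i [^]\<^bsub>K\<^esub> (n::nat) \<in> ideal_power R I n"
proof (induction n)
  case (Suc n)
  then show ?case using ideal_prod.prod[of "i [^]\<^bsub>K\<^esub> n" "ideal_power R I n" i I R] assms(2)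
    by (simp add: R_ops)
qed simp

lemma transform_subset_Omega:
  assumes I: "ideal I R" shows "ideal_transform R K I \<subseteq> Omega_transform R K I"
proof
  fix z assume "z \<in> ideal_transform R K I"
  then obtain n where z: "z \<in> carrier K" and n: "\<And>x. x \<in> ideal_power R I n \<Longrightarrow> z \<otimes>\<^bsub>K\<^esub> x \<in> carrier R"
    by (auto simp: ideal_transform_def colon_inv_def)
  \<comment> \<open>One power more than needed: \<open>n\<close> may be 0, while
    \<open>Omega_transform\<close> asks for a positive exponent.\<close>
  have "z \<otimes>\<^bsub>K\<^esub> i [^]\<^bsub>K\<^esub> Suc n \<in> carrier R" if i: "i \<in> I" for i
  proof -
    have iR: "i \<in> carrier R" using ideal_K(1)[OF I i] .
    have "(z \<otimes>\<^bsub>K\<^esub> i [^]\<^bsub>K\<^esub> n) \<otimes>\<^bsub>K\<^esub> i \<in> carrier R"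
      using n[OF pow_mem_ideal_power[OF I i]] iR by simp
    then show ?thesis using z iR by (simp add: K.m_assoc R_sub)
  qed
  then show "z \<in> Omega_transform R K I"
    using z unfolding Omega_transform_def by blast
qed

text \<open>A maximal ideal above the conductor also contains its radical, hence
  \<open>I\<close>.\<close>

lemma Omega_subset_Theta:
  assumes I: "ideal I R" shows "Omega_transform R K I \<subseteq> Theta_transform R K I"
proof
  fix z assume "z \<in> Omega_transform R K I"
  then have z: "z \<in> carrier K" "I \<subseteq> ideal_radical R (conductor R K z)"
    using mem_Omega[of I z] ideal_K(1)[OF I] by auto
  then have "I \<subseteq> N" if "maximalideal N R" "conductor R K z \<subseteq> N" for N
    using R.ideal_radical_subset_prime[OF R.maximalideal_prime[OF that(1)] that(2)] by auto
  then show "z \<in> Theta_transform R K I" using z(1) mem_Theta by blast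
qed

section \<open>Inverses, invertible and divisorial ideals\<close>

lemma mem_colon_inv:
  assumes "I \<subseteq> carrier R"
  shows "z \<in> colon_inv R K I \<longleftrightarrow> z \<in> carrier K \<and> I \<subseteq> conductor R K z"
  using assms mem_conductor by (auto simp: colon_inv_def)

lemma carrier_subset_colon_inv:
  assumes "I \<subseteq> carrier R" shows "carrier R \<subseteq> colon_inv R K I"
  using assms by (auto simp: colon_inv_def R_sub)

lemma colon_inv_carrier: "colon_inv R K (carrier R) = carrier R"
  using carrier_subset_colon_inv[of "carrier R"] by (force simp: colon_inv_def dest: bspec[of _ _ "\<one>\<^bsub>K\<^esub>"])

text \<open>If the inverse were \<open>R\<close>, the \<open>v\<close>-closure would be the inverse
  of \<open>R\<close>, which is \<open>R\<close> again.\<close>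

lemma divisorial_proper_colon_inv:
  assumes "divisorial R K I" "I \<noteq> carrier R"
  shows "colon_inv R K I \<noteq> carrier R"
  using assms colon_inv_carrier by (auto simp: divisorial_def v_closure_def)

lemma invertible_colon_inv:
  assumes I: "invertible_ideal R K I" and "I \<noteq> carrier R"
  shows "colon_inv R K I \<noteq> carrier R"
proof
  assume eq: "colon_inv R K I = carrier R"
  have Ii: "ideal I R" and "\<one>\<^bsub>K\<^esub> \<in> I \<cdot>\<^bsub>K\<^esub> carrier R"
    using I eq by (auto simp: invertible_ideal_def)
  moreover have "x \<in> I" if "x \<in> I \<cdot>\<^bsub>K\<^esub> carrier R" for x
    using that by (induction x rule: ideal_prod.induct) (auto simp: ideal_K[OF Ii])
  ultimately show False using ideal_proper[OF Ii] assms(2) by blast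
qed

lemma invertible_imp_divisorial:
  assumes I: "invertible_ideal R K I" and nz: "I \<noteq> {\<zero>\<^bsub>R\<^esub>}"
  shows "divisorial R K I"
proof -
  have Ii: "ideal I R" and one: "\<one>\<^bsub>K\<^esub> \<in> I \<cdot>\<^bsub>K\<^esub> colon_inv R K I"
    using I by (auto simp: invertible_ideal_def)
  have IR: "I \<subseteq> carrier R" using ideal_K(1)[OF Ii] by auto
  have cK: "w \<in> carrier K" if "w \<in> colon_inv R K I" for w using that by (simp add: colon_inv_def)
  have "I \<subseteq> v_closure R K I"
  proof
    fix x assume x: "x \<in> I"
    have "x \<in> carrier K" using x IR R_sub by auto
    moreover have "x \<otimes>\<^bsub>K\<^esub> w \<in> carrier R" if "w \<in> colon_inv R K I" for w
      using that x K.m_comm[OF cK[OF that] \<open>x \<in> carrier K\<close>] by (auto simp: colon_inv_def)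
    ultimately show "x \<in> v_closure R K I"
      by (auto simp: v_closure_def colon_inv_def[of R K "colon_inv R K I"])
  qed
  moreover have "v_closure R K I \<subseteq> I"
  proof
    fix x assume x: "x \<in> v_closure R K I"
    then have xK: "x \<in> carrier K"
      and xw: "\<And>w. w \<in> colon_inv R K I \<Longrightarrow> x \<otimes>\<^bsub>K\<^esub> w \<in> carrier R"
      by (auto simp: v_closure_def colon_inv_def[of R K "colon_inv R K I"])
    \<comment> \<open>Proved for all \<open>u\<close> of the product so that induction applies; only
      \<open>u = 1\<close> is wanted. The reason is that \<open>x (i w) = (x w) i\<close> with
      \<open>x w\<close> in \<open>R\<close>.\<close>
    have "u \<in> carrier K \<and> x \<otimes>\<^bsub>K\<^esub> u \<in> I" if "u \<in> I \<cdot>\<^bsub>K\<^esub> colon_inv R K I" for u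
      using that
    proof (induction u rule: ideal_prod.induct)
      case (prod i w)
      have "i \<in> carrier K" using prod(1) IR R_sub by auto
      then have "x \<otimes>\<^bsub>K\<^esub> (i \<otimes>\<^bsub>K\<^esub> w) = (x \<otimes>\<^bsub>K\<^esub> w) \<otimes>\<^bsub>K\<^esub> i" using xK cK[OF prod(2)] by (simp add: K.m_ac)
      then show ?case using ideal_K(4)[OF Ii xw[OF prod(2)] prod(1)] \<open>i \<in> carrier K\<close> cK[OF prod(2)] by simp
    next
      case (sum u v)
      then show ?case using xK ideal_K(3)[OF Ii] by (simp add: K.r_distr)
    qed
    from this[OF one] show "x \<in> I" using xK by simp
  qed
  ultimately show ?thesis using Ii nz by (simp add: divisorial_def)
qed

text \<open>If 1 is a sum of products \<open>i w\<close>, then every \<open>y\<close> in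
  \<open>I\<close> is the corresponding sum of the \<open>(w y) i\<close>, so the finitely many
  \<open>i\<close> generate. The induction collects them in \<open>S\<close> along the way.\<close>

lemma invertible_imp_fin_gen:
  assumes I: "invertible_ideal R K I"
  shows "fin_gen_ideal R I"
proof -
  have Ii: "ideal I R" and one: "\<one>\<^bsub>K\<^esub> \<in> I \<cdot>\<^bsub>K\<^esub> colon_inv R K I"
    using I by (auto simp: invertible_ideal_def)
  have IR: "I \<subseteq> carrier R" using ideal_K(1)[OF Ii] by auto
  have "u \<in> carrier K \<and> (\<exists>S. finite S \<and> S \<subseteq> I \<and> (\<forall>y \<in> I. y \<otimes>\<^bsub>K\<^esub> u \<in> Idl\<^bsub>R\<^esub> S))"
    if "u \<in> I \<cdot>\<^bsub>K\<^esub> colon_inv R K I" for u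
    using that
  proof (induction u rule: ideal_prod.induct)
    case (prod i w)
    have iR: "i \<in> carrier R" and w: "w \<in> carrier K" "\<And>y. y \<in> I \<Longrightarrow> w \<otimes>\<^bsub>K\<^esub> y \<in> carrier R"
      using prod IR by (auto simp: colon_inv_def)
    have "y \<otimes>\<^bsub>K\<^esub> (i \<otimes>\<^bsub>K\<^esub> w) \<in> Idl\<^bsub>R\<^esub> {i}" if y: "y \<in> I" for y
    proof -
      have "y \<in> carrier K" using y IR R_sub by auto
      then have "y \<otimes>\<^bsub>K\<^esub> (i \<otimes>\<^bsub>K\<^esub> w) = (w \<otimes>\<^bsub>K\<^esub> y) \<otimes>\<^bsub>K\<^esub> i" using iR w(1) by (simp add: K.m_ac R_sub)
      then show ?thesis using w(2)[OF y] R.mem_Idl_singleton[OF iR] by (auto simp: R_ops)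
    qed
    then show ?case using prod(1) iR w(1) R_sub
      by (auto intro!: exI[of _ "{i}"])
  next
    case (sum u v)
    then obtain S T where S: "finite S" "S \<subseteq> I" "\<And>y. y \<in> I \<Longrightarrow> y \<otimes>\<^bsub>K\<^esub> u \<in> Idl\<^bsub>R\<^esub> S"
      and T: "finite T" "T \<subseteq> I" "\<And>y. y \<in> I \<Longrightarrow> y \<otimes>\<^bsub>K\<^esub> v \<in> Idl\<^bsub>R\<^esub> T"
      and uv: "u \<in> carrier K" "v \<in> carrier K" by blast
    have c: "S \<union> T \<subseteq> carrier R" using S T IR by auto
    have "Idl\<^bsub>R\<^esub> S \<subseteq> Idl\<^bsub>R\<^esub> (S \<union> T)" "Idl\<^bsub>R\<^esub> T \<subseteq> Idl\<^bsub>R\<^esub> (S \<union> T)"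
      using R.subset_Idl_subset[OF c] by auto
    moreover have "y \<otimes>\<^bsub>K\<^esub> (u \<oplus>\<^bsub>K\<^esub> v) = y \<otimes>\<^bsub>K\<^esub> u \<oplus>\<^bsub>K\<^esub> y \<otimes>\<^bsub>K\<^esub> v" if "y \<in> I" for y
      using that uv IR R_sub by (auto simp: K.r_distr)
    ultimately have "\<forall>y \<in> I. y \<otimes>\<^bsub>K\<^esub> (u \<oplus>\<^bsub>K\<^esub> v) \<in> Idl\<^bsub>R\<^esub> (S \<union> T)"
      using S(3) T(3) ideal_K(3)[OF R.genideal_ideal[OF c]] by (metis subsetD)
    then show ?case using S T uv by (auto intro!: exI[of _ "S \<union> T"])
  qed
  from this[OF one] obtain S where S: "finite S" "S \<subseteq> I" "\<forall>y \<in> I. y \<otimes>\<^bsub>K\<^esub> \<one>\<^bsub>K\<^esub> \<in> Idl\<^bsub>R\<^esub> S" by blast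
  have "I \<subseteq> Idl\<^bsub>R\<^esub> S"
  proof
    fix y assume "y \<in> I"
    then show "y \<in> Idl\<^bsub>R\<^esub> S" using bspec[OF S(3), of y] IR R_sub[of y] by auto
  qed
  then have "I = Idl\<^bsub>R\<^esub> S" using R.genideal_minimal[OF Ii S(2)] by auto
  then show ?thesis using S IR unfolding fin_gen_ideal_def by blast
qed

lemma mem_sharp:
  assumes "maximalideal M R" "M \<noteq> {\<zero>\<^bsub>R\<^esub>}"
  shows "sharp_prime R K M \<longleftrightarrow> (\<exists>z \<in> carrier K. in_no_other_maximal R M (conductor R K z))"
proof -
  have eq: "M \<subseteq> N \<longleftrightarrow> N = M" if "maximalideal N R" for N
    using maximalideal_properties(4)[OF assms(1), of N] maximalideal_properties[OF that] by auto
  have "z \<in> Theta_transform R K M \<and> z \<notin> carrier (loc_at R K M) \<longleftrightarrow>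
      z \<in> carrier K \<and> in_no_other_maximal R M (conductor R K z)" for z
  proof (cases "z \<in> carrier K")
    case True
    have "(\<forall>N. maximalideal N R \<longrightarrow> conductor R K z \<subseteq> N \<longrightarrow> M \<subseteq> N) \<longleftrightarrow>
        (\<forall>N. maximalideal N R \<and> conductor R K z \<subseteq> N \<longrightarrow> N = M)"
      using eq by metis
    then show ?thesis
      unfolding mem_Theta in_no_other_maximal_def mem_loc_at_iff_conductor[OF assms(1) True] by auto
  qed (simp add: mem_Theta)
  then show ?thesis
    unfolding sharp_prime_def using assms(2) R.maximalideal_prime[OF assms(1)] by blast
qed

section \<open>The localization as a ring, and the extension of \<open>M\<close> to it\<close>

lemma loc_at_cring:
  assumes N: "maximalideal N R"
  shows "cring (loc_at R K N)"
proof -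
  let ?V = "carrier (loc_at R K N)"
  note V = mem_loc_at[OF N]
  note NN = maximal_K[OF N]
  have "subring ?V K"
  proof (rule K.subringI)
    show "?V \<subseteq> carrier K" using V by auto
    show "\<one>\<^bsub>K\<^esub> \<in> ?V" using NN(2) by (auto simp: V R_sub intro!: exI[of _ "\<one>\<^bsub>K\<^esub>"])
    fix h assume h: "h \<in> ?V"
    then obtain s where s: "h \<in> carrier K" "s \<in> carrier R" "s \<notin> N" "s \<otimes>\<^bsub>K\<^esub> h \<in> carrier R" using V by auto
    have "s \<otimes>\<^bsub>K\<^esub> (\<ominus>\<^bsub>K\<^esub> h) = \<ominus>\<^bsub>K\<^esub> (s \<otimes>\<^bsub>K\<^esub> h)" using s by (simp add: K.r_minus R_sub)
    then show "\<ominus>\<^bsub>K\<^esub> h \<in> ?V"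
      using s R_a_inv_closed[OF s(4)] by (intro iffD2[OF V] conjI bexI[of _ s]) auto
    fix g assume "g \<in> ?V"
    then obtain t where t: "g \<in> carrier K" "t \<in> carrier R" "t \<notin> N" "t \<otimes>\<^bsub>K\<^esub> g \<in> carrier R" using V by auto
    have st: "s \<otimes>\<^bsub>K\<^esub> t \<in> carrier R - N" using NN(5)[of s t] s t by auto
    have "(s \<otimes>\<^bsub>K\<^esub> t) \<otimes>\<^bsub>K\<^esub> (h \<otimes>\<^bsub>K\<^esub> g) = (s \<otimes>\<^bsub>K\<^esub> h) \<otimes>\<^bsub>K\<^esub> (t \<otimes>\<^bsub>K\<^esub> g)"
      using s(1,2) t(1,2) by (simp add: K.m_ac R_sub)
    then show "h \<otimes>\<^bsub>K\<^esub> g \<in> ?V" using s(1,4) t(1,4) st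
      by (intro iffD2[OF V] conjI bexI[of _ "s \<otimes>\<^bsub>K\<^esub> t"]) auto
    have "(s \<otimes>\<^bsub>K\<^esub> t) \<otimes>\<^bsub>K\<^esub> (h \<oplus>\<^bsub>K\<^esub> g) = t \<otimes>\<^bsub>K\<^esub> (s \<otimes>\<^bsub>K\<^esub> h) \<oplus>\<^bsub>K\<^esub> s \<otimes>\<^bsub>K\<^esub> (t \<otimes>\<^bsub>K\<^esub> g)"
      using s(1,2) t(1,2) by (simp add: K.m_ac K.r_distr R_sub)
    then show "h \<oplus>\<^bsub>K\<^esub> g \<in> ?V" using s(1,2,4) t(1,2,4) st
      by (intro iffD2[OF V] conjI bexI[of _ "s \<otimes>\<^bsub>K\<^esub> t"]) auto
  qed
  then have "subcring ?V K" by (rule K.subcringI')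
  then have "cring (K\<lparr>carrier := ?V\<rparr>)" using K.subcring_iff[of ?V] V by auto
  then show ?thesis by (simp add: loc_at_def)
qed

lemma carrier_subset_loc_at:
  assumes "maximalideal N R" shows "carrier R \<subseteq> carrier (loc_at R K N)"
  using maximal_K(2)[OF assms]
  by (auto simp: mem_loc_at[OF assms] R_sub intro!: exI[of _ "\<one>\<^bsub>K\<^esub>"])

lemma loc_at_ops:
  "x \<otimes>\<^bsub>loc_at R K N\<^esub> y = x \<otimes>\<^bsub>K\<^esub> y" "x \<oplus>\<^bsub>loc_at R K N\<^esub> y = x \<oplus>\<^bsub>K\<^esub> y"
  "\<one>\<^bsub>loc_at R K N\<^esub> = \<one>\<^bsub>K\<^esub>" "\<zero>\<^bsub>loc_at R K N\<^esub> = \<zero>\<^bsub>K\<^esub>"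
  by (simp_all add: loc_at_def)

text \<open>The set \<open>?E\<close> of elements that a denominator outside \<open>M\<close> brings
  into \<open>M\<close> is an ideal of the localization containing \<open>M\<close>, hence contains
  the generated ideal.\<close>

lemma extension_subset:
  assumes M: "maximalideal M R" and x: "x \<in> Idl\<^bsub>loc_at R K M\<^esub> M"
  shows "\<exists>s \<in> carrier R - M. s \<otimes>\<^bsub>K\<^esub> x \<in> M"
proof -
  interpret V: cring "loc_at R K M" using loc_at_cring[OF M] .
  note MK = maximal_K[OF M] and V = mem_loc_at[OF M]
  note Mi = ideal_K[OF MK(1)]
  let ?E = "{z \<in> carrier K. \<exists>s \<in> carrier R - M. s \<otimes>\<^bsub>K\<^esub> z \<in> M}"
  have "ideal ?E (loc_at R K M)"
  proof (rule V.idealI_cring)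
    show "?E \<subseteq> carrier (loc_at R K M)" using Mi(1) unfolding V subset_iff by blast
    show "\<zero>\<^bsub>loc_at R K M\<^esub> \<in> ?E" using MK by (auto simp: loc_at_ops intro!: bexI[of _ "\<one>\<^bsub>K\<^esub>"])
  next
    fix g h assume "g \<in> ?E" "h \<in> ?E"
    then obtain s t where s: "g \<in> carrier K" "s \<in> carrier R" "s \<notin> M" "s \<otimes>\<^bsub>K\<^esub> g \<in> M"
      and t: "h \<in> carrier K" "t \<in> carrier R" "t \<notin> M" "t \<otimes>\<^bsub>K\<^esub> h \<in> M" by auto
    have "(s \<otimes>\<^bsub>K\<^esub> t) \<otimes>\<^bsub>K\<^esub> (g \<oplus>\<^bsub>K\<^esub> h) = t \<otimes>\<^bsub>K\<^esub> (s \<otimes>\<^bsub>K\<^esub> g) \<oplus>\<^bsub>K\<^esub> s \<otimes>\<^bsub>K\<^esub> (t \<otimes>\<^bsub>K\<^esub> h)"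
      using s(1,2) t(1,2) by (simp add: K.m_ac K.r_distr R_sub)
    then have "(s \<otimes>\<^bsub>K\<^esub> t) \<otimes>\<^bsub>K\<^esub> (g \<oplus>\<^bsub>K\<^esub> h) \<in> M"
      using Mi(3)[OF Mi(4)[OF t(2) s(4)] Mi(4)[OF s(2) t(4)]] by simp
    moreover have "s \<otimes>\<^bsub>K\<^esub> t \<in> carrier R - M" using s t MK(5)[of s t] by auto
    ultimately show "g \<oplus>\<^bsub>loc_at R K M\<^esub> h \<in> ?E" using s(1) t(1) by (auto simp: loc_at_ops)
  next
    fix g h assume "g \<in> carrier (loc_at R K M)" "h \<in> ?E"
    then obtain s t where s: "g \<in> carrier K" "s \<in> carrier R" "s \<notin> M" "s \<otimes>\<^bsub>K\<^esub> g \<in> carrier R"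
      and t: "h \<in> carrier K" "t \<in> carrier R" "t \<notin> M" "t \<otimes>\<^bsub>K\<^esub> h \<in> M" by (auto simp: V)
    have "(s \<otimes>\<^bsub>K\<^esub> t) \<otimes>\<^bsub>K\<^esub> (g \<otimes>\<^bsub>K\<^esub> h) = (s \<otimes>\<^bsub>K\<^esub> g) \<otimes>\<^bsub>K\<^esub> (t \<otimes>\<^bsub>K\<^esub> h)"
      using s(1,2) t(1,2) by (simp add: K.m_ac R_sub)
    then have "(s \<otimes>\<^bsub>K\<^esub> t) \<otimes>\<^bsub>K\<^esub> (g \<otimes>\<^bsub>K\<^esub> h) \<in> M" using Mi(4)[OF s(4) t(4)] by simp
    moreover have "s \<otimes>\<^bsub>K\<^esub> t \<in> carrier R - M" using s t MK(5)[of s t] by auto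
    ultimately show "g \<otimes>\<^bsub>loc_at R K M\<^esub> h \<in> ?E" using s(1) t(1) by (auto simp: loc_at_ops)
  qed
  moreover have "M \<subseteq> ?E" using MK by (auto simp: R_sub intro!: bexI[of _ "\<one>\<^bsub>K\<^esub>"])
  ultimately show ?thesis using V.genideal_minimal[of ?E M] x by blast
qed

text \<open>At a maximal ideal other than \<open>M\<close> the extension of \<open>M\<close> is the
  unit ideal, so the condition concerns \<open>M\<close> alone.\<close>

lemma locally_principal_iff:
  assumes M: "maximalideal M R"
  shows "locally_principal R K M \<longleftrightarrow> (\<exists>m \<in> M. \<forall>x \<in> M. locally_divides R M m x)"
proof
  assume "locally_principal R K M"
  then have "principalideal (Idl\<^bsub>loc_at R K M\<^esub> M) (loc_at R K M)"
    using M by (simp add: locally_principal_def)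
  interpret V: cring "loc_at R K M" using loc_at_cring[OF M] .
  note MK = maximal_K[OF M] and V = mem_loc_at[OF M]
  have MV: "M \<subseteq> carrier (loc_at R K M)" using carrier_subset_loc_at[OF M] MK(4) by auto
  obtain g where g: "g \<in> carrier (loc_at R K M)" "Idl\<^bsub>loc_at R K M\<^esub> M = Idl\<^bsub>loc_at R K M\<^esub> {g}"
    using principalideal.generate[OF \<open>principalideal _ _\<close>] by blast
  have "g \<in> Idl\<^bsub>loc_at R K M\<^esub> M" using g V.genideal_self'[OF g(1)] by simp
  then obtain s where s: "s \<in> carrier R" "s \<notin> M" "s \<otimes>\<^bsub>K\<^esub> g \<in> M" using extension_subset[OF M] by blast
  have gK: "g \<in> carrier K" using g(1) V by auto
  \<comment> \<open>The generator \<open>g\<close> need not lie in \<open>R\<close>; its multiple by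
    the local unit \<open>s\<close> lies in \<open>M\<close> and generates the same ideal.\<close>
  have "locally_divides R M (s \<otimes>\<^bsub>K\<^esub> g) x" if x: "x \<in> M" for x
  proof -
    have "x \<in> Idl\<^bsub>loc_at R K M\<^esub> {g}" using V.genideal_self[OF MV] g(2) x by auto
    then obtain v where v: "v \<in> carrier (loc_at R K M)" "x = v \<otimes>\<^bsub>K\<^esub> g"
      using V.mem_Idl_singleton[OF g(1)] by (auto simp: loc_at_ops)
    then obtain t where t: "v \<in> carrier K" "t \<in> carrier R" "t \<notin> M" "t \<otimes>\<^bsub>K\<^esub> v \<in> carrier R"
      using V by auto
    have "(s \<otimes>\<^bsub>K\<^esub> t) \<otimes>\<^bsub>K\<^esub> x = (t \<otimes>\<^bsub>K\<^esub> v) \<otimes>\<^bsub>K\<^esub> (s \<otimes>\<^bsub>K\<^esub> g)"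
      unfolding v(2) using s(1) t(1,2) gK by (simp add: K.m_ac R_sub)
    moreover have "s \<otimes>\<^bsub>K\<^esub> t \<in> carrier R - M" using s t MK(5)[of s t] by auto
    ultimately show ?thesis using t(4) by (auto simp: locally_divides_def R_ops)
  qed
  then show "\<exists>m \<in> M. \<forall>x \<in> M. locally_divides R M m x" using s(3) by auto
next
  assume "\<exists>m \<in> M. \<forall>x \<in> M. locally_divides R M m x"
  then obtain m where m: "m \<in> M" "\<And>x. x \<in> M \<Longrightarrow> locally_divides R M m x" by auto
  note MK = maximal_K[OF M]
  have "\<exists>g \<in> carrier (loc_at R K N). Idl\<^bsub>loc_at R K N\<^esub> M = Idl\<^bsub>loc_at R K N\<^esub> {g}"
    and "ideal (Idl\<^bsub>loc_at R K N\<^esub> M) (loc_at R K N)"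
    if N: "maximalideal N R" for N
  proof -
    interpret V: cring "loc_at R K N" using loc_at_cring[OF N] .
    note NK = maximal_K[OF N] and V = mem_loc_at[OF N]
    have RV: "x \<in> carrier (loc_at R K N)" if "x \<in> carrier R" for x
      using carrier_subset_loc_at[OF N] that by auto
    then have MV: "M \<subseteq> carrier (loc_at R K N)" using MK(4) by auto
    show Ei: "ideal (Idl\<^bsub>loc_at R K N\<^esub> M) (loc_at R K N)" using V.genideal_ideal[OF MV] .
    show "\<exists>g \<in> carrier (loc_at R K N). Idl\<^bsub>loc_at R K N\<^esub> M = Idl\<^bsub>loc_at R K N\<^esub> {g}"
    proof (cases "N = M")
      case True
      have mV: "m \<in> carrier (loc_at R K N)" using MV m by auto
      have "x \<in> Idl\<^bsub>loc_at R K N\<^esub> {m}" if x: "x \<in> M" for x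
      proof -
        obtain s r where s: "s \<in> carrier R" "s \<notin> M" "r \<in> carrier R" "s \<otimes>\<^bsub>K\<^esub> x = r \<otimes>\<^bsub>K\<^esub> m"
          using m(2)[OF x] by (auto simp: locally_divides_def R_ops)
        then have "s \<noteq> \<zero>\<^bsub>K\<^esub>" using MK(3) by auto
        note inv = K_inv[OF R_sub[OF s(1)] this]
        have xm: "x \<in> carrier K" "m \<in> carrier K" using x m MK(4) R_sub by auto
        have "x = (inv\<^bsub>K\<^esub> s \<otimes>\<^bsub>K\<^esub> s) \<otimes>\<^bsub>K\<^esub> x" using inv xm by simp
        also have "\<dots> = inv\<^bsub>K\<^esub> s \<otimes>\<^bsub>K\<^esub> (r \<otimes>\<^bsub>K\<^esub> m)"
          using inv(1) xm s by (simp add: K.m_assoc R_sub)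
        also have "\<dots> = (r \<otimes>\<^bsub>K\<^esub> inv\<^bsub>K\<^esub> s) \<otimes>\<^bsub>K\<^esub> m" using inv(1) xm s(1,3) by (simp add: K.m_ac R_sub)
        finally have "x = (r \<otimes>\<^bsub>K\<^esub> inv\<^bsub>K\<^esub> s) \<otimes>\<^bsub>K\<^esub> m" .
        moreover have "r \<otimes>\<^bsub>K\<^esub> inv\<^bsub>K\<^esub> s \<in> carrier (loc_at R K N)" using s True by (auto simp: loc_at_def)
        ultimately show ?thesis using V.mem_Idl_singleton[OF mV] by (auto simp: loc_at_ops)
      qed
      then have "Idl\<^bsub>loc_at R K N\<^esub> M \<subseteq> Idl\<^bsub>loc_at R K N\<^esub> {m}"
        using V.genideal_ideal[of "{m}"] mV by (intro V.genideal_minimal) auto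
      moreover have "Idl\<^bsub>loc_at R K N\<^esub> {m} \<subseteq> Idl\<^bsub>loc_at R K N\<^esub> M"
        using V.subset_Idl_subset[OF MV] m by auto
      ultimately show ?thesis using mV by blast
    next
      case False
      then have "\<not> M \<subseteq> N"
        using maximalideal_properties(4)[OF M NK(1)] maximalideal_properties(3)[OF N] by auto
      \<comment> \<open>An element of \<open>M\<close> outside \<open>N\<close> is a unit in the
        localization at \<open>N\<close>.\<close>
      then obtain u where u: "u \<in> M" "u \<notin> N" by auto
      have uR: "u \<in> carrier R" using MK(4) u by auto
      have "u \<noteq> \<zero>\<^bsub>K\<^esub>" using u NK(3) by auto
      note inv = K_inv[OF R_sub[OF uR] this]
      have "inv\<^bsub>K\<^esub> u \<in> carrier (loc_at R K N)"
        using inv uR u(2) by (auto simp: V intro!: bexI[of _ u])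
      then have "inv\<^bsub>K\<^esub> u \<otimes>\<^bsub>loc_at R K N\<^esub> u \<in> Idl\<^bsub>loc_at R K N\<^esub> M"
        using ideal.I_l_closed[OF Ei] V.genideal_self[OF MV] u(1) by auto
      then have "\<one>\<^bsub>loc_at R K N\<^esub> \<in> Idl\<^bsub>loc_at R K N\<^esub> M" using inv by (simp add: loc_at_ops)
      then have "Idl\<^bsub>loc_at R K N\<^esub> M = carrier (loc_at R K N)" by (rule ideal.one_imp_carrier[OF Ei])
      then show ?thesis using V.genideal_one V.one_closed by metis
    qed
  qed
  then show "locally_principal R K M" by (auto simp: locally_principal_def intro!: principalidealI)
qed

end


section \<open>Pruefer domains\<close>

context prufer_domain
begin

text \<open>For \<open>z = a / b\<close>, these \<open>s\<close> and \<open>t\<close> come from writing \<open>1 = a x + b y\<close> with \<open>x\<close>, \<open>y\<close> in the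
  inverse of the ideal generated by \<open>a\<close> and \<open>b\<close>: put \<open>s = b y\<close> and \<open>t = b x\<close>.\<close>

lemma exists_conductor_generators:
  assumes z: "z \<in> carrier K"
  obtains s t where "s \<in> conductor R K z" "t \<in> conductor R K z"
    "s \<oplus>\<^bsub>K\<^esub> t \<otimes>\<^bsub>K\<^esub> z = \<one>\<^bsub>K\<^esub>"
proof -
  obtain b where b: "b \<in> conductor R K z" "b \<noteq> \<zero>\<^bsub>K\<^esub>" by (rule conductor_nonzero[OF z])
  define a where "a = b \<otimes>\<^bsub>K\<^esub> z"
  have aR: "a \<in> carrier R" and bR: "b \<in> carrier R" using b by (auto simp: a_def conductor_def)
  have aK: "a \<in> carrier K" and bK: "b \<in> carrier K" using aR bR R_sub by auto
  let ?I = "Idl\<^bsub>R\<^esub> {a, b}"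
  let ?C = "colon_inv R K ?I"
  have c: "{a, b} \<subseteq> carrier R" using aR bR by auto
  have mem: "a \<in> ?I" "b \<in> ?I" using R.genideal_self[OF c] by auto
  have "?I \<noteq> {\<zero>\<^bsub>R\<^esub>}" using mem b(2) by (auto simp: R_ops)
  moreover have "fin_gen_ideal R ?I" using c unfolding fin_gen_ideal_def by blast
  ultimately have "invertible_ideal R K ?I" by (intro fin_gen_invertible)
  then have one: "\<one>\<^bsub>K\<^esub> \<in> ?I \<cdot>\<^bsub>K\<^esub> ?C" by (simp add: invertible_ideal_def)
  have IR: "i \<in> carrier R" if "i \<in> ?I" for i using ideal.Icarr[OF R.genideal_ideal[OF c] that] .
  have C: "w \<in> ?C \<longleftrightarrow> w \<in> carrier K \<and> (\<forall>i \<in> ?I. w \<otimes>\<^bsub>K\<^esub> i \<in> carrier R)" for w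
    by (simp add: colon_inv_def)
  have Cadd: "w \<oplus>\<^bsub>K\<^esub> v \<in> ?C" if "w \<in> ?C" "v \<in> ?C" for w v
    using that by (auto simp: C K.l_distr IR R_sub)
  have Cmult: "r \<otimes>\<^bsub>K\<^esub> w \<in> ?C" if "w \<in> ?C" "r \<in> carrier R" for r w
    using that by (auto simp: C K.m_assoc IR R_sub)
  \<comment> \<open>The coefficients of \<open>i\<close> with respect to \<open>a\<close> and
    \<open>b\<close> are absorbed into \<open>w\<close>, since \<open>?C\<close> is closed under
    addition and under multiplication by \<open>R\<close>.\<close>
  have "\<exists>x \<in> ?C. \<exists>y \<in> ?C. u = a \<otimes>\<^bsub>K\<^esub> x \<oplus>\<^bsub>K\<^esub> b \<otimes>\<^bsub>K\<^esub> y" if "u \<in> ?I \<cdot>\<^bsub>K\<^esub> ?C" for u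
    using that
  proof (induction u rule: ideal_prod.induct)
    case (prod i w)
    obtain r q where rq: "i = r \<otimes>\<^bsub>K\<^esub> a \<oplus>\<^bsub>K\<^esub> q \<otimes>\<^bsub>K\<^esub> b" "r \<in> carrier R" "q \<in> carrier R"
      using subsetD[OF R.Idl_pair_subset[OF aR bR] prod(1)] by (auto simp: R_ops)
    have wK: "w \<in> carrier K" using prod(2) C by auto
    have "i \<otimes>\<^bsub>K\<^esub> w = a \<otimes>\<^bsub>K\<^esub> (r \<otimes>\<^bsub>K\<^esub> w) \<oplus>\<^bsub>K\<^esub> b \<otimes>\<^bsub>K\<^esub> (q \<otimes>\<^bsub>K\<^esub> w)"
      unfolding rq(1) using R_sub[OF rq(2)] R_sub[OF rq(3)] aK bK wK
      by (simp add: K.l_distr K.r_distr K.m_ac)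
    then show ?case using Cmult[OF prod(2)] rq(2,3) by blast
  next
    case (sum u v)
    then obtain x y x' y' where u: "x \<in> ?C" "y \<in> ?C" "u = a \<otimes>\<^bsub>K\<^esub> x \<oplus>\<^bsub>K\<^esub> b \<otimes>\<^bsub>K\<^esub> y"
      and v: "x' \<in> ?C" "y' \<in> ?C" "v = a \<otimes>\<^bsub>K\<^esub> x' \<oplus>\<^bsub>K\<^esub> b \<otimes>\<^bsub>K\<^esub> y'" by blast
    have "x \<in> carrier K" "y \<in> carrier K" "x' \<in> carrier K" "y' \<in> carrier K"
      using u(1,2) v(1,2) C by auto
    then have "u \<oplus>\<^bsub>K\<^esub> v = a \<otimes>\<^bsub>K\<^esub> (x \<oplus>\<^bsub>K\<^esub> x') \<oplus>\<^bsub>K\<^esub> b \<otimes>\<^bsub>K\<^esub> (y \<oplus>\<^bsub>K\<^esub> y')"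
      unfolding u(3) v(3) using aK bK by (simp add: K.r_distr K.a_ac)
    then show ?case using Cadd[OF u(1) v(1)] Cadd[OF u(2) v(2)] by blast
  qed
  from this[OF one] obtain x y where xy: "x \<in> ?C" "y \<in> ?C"
    "\<one>\<^bsub>K\<^esub> = a \<otimes>\<^bsub>K\<^esub> x \<oplus>\<^bsub>K\<^esub> b \<otimes>\<^bsub>K\<^esub> y" by blast
  have xK: "x \<in> carrier K" and yK: "y \<in> carrier K" using xy C by auto
  have m: "b \<otimes>\<^bsub>K\<^esub> w \<in> conductor R K z" if w: "w \<in> ?C" for w
  proof -
    have wK: "w \<in> carrier K" and wa: "w \<otimes>\<^bsub>K\<^esub> a \<in> carrier R" and wb: "w \<otimes>\<^bsub>K\<^esub> b \<in> carrier R"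
      using w mem C by auto
    have "(b \<otimes>\<^bsub>K\<^esub> w) \<otimes>\<^bsub>K\<^esub> z = w \<otimes>\<^bsub>K\<^esub> a" unfolding a_def using bK wK z by (simp add: K.m_ac)
    moreover have "b \<otimes>\<^bsub>K\<^esub> w = w \<otimes>\<^bsub>K\<^esub> b" using bK wK by (rule K.m_comm)
    ultimately show ?thesis using wa wb by (simp add: conductor_def)
  qed
  have "b \<otimes>\<^bsub>K\<^esub> y \<oplus>\<^bsub>K\<^esub> (b \<otimes>\<^bsub>K\<^esub> x) \<otimes>\<^bsub>K\<^esub> z = \<one>\<^bsub>K\<^esub>"
    unfolding xy(3) a_def using bK xK yK z by (simp add: K.m_ac K.a_comm)
  then show ?thesis using that[OF m[OF xy(2)] m[OF xy(1)]] by simp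
qed

text \<open>The two elements \<open>s\<close> and \<open>t\<close> generate:
  \<open>r = r (s + t z) = r s + (r z) t\<close>, and \<open>r z\<close> is in \<open>R\<close> for
  \<open>r\<close> in the conductor.\<close>

lemma conductor_fin_gen:
  assumes z: "z \<in> carrier K" shows "fin_gen_ideal R (conductor R K z)"
proof -
  obtain s t where st: "s \<in> conductor R K z" "t \<in> conductor R K z"
    "s \<oplus>\<^bsub>K\<^esub> t \<otimes>\<^bsub>K\<^esub> z = \<one>\<^bsub>K\<^esub>" by (rule exists_conductor_generators[OF z])
  have c: "{s, t} \<subseteq> carrier R" using st by (auto simp: conductor_def)
  have cK: "s \<in> carrier K" "t \<in> carrier K" using c R_sub by auto
  note Ii = ideal_K[OF R.genideal_ideal[OF c]]
  have "conductor R K z \<subseteq> Idl\<^bsub>R\<^esub> {s, t}"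
  proof
    fix r assume "r \<in> conductor R K z"
    then have r: "r \<in> carrier R" "r \<otimes>\<^bsub>K\<^esub> z \<in> carrier R" by (auto simp: conductor_def)
    have rK: "r \<in> carrier K" using r R_sub by auto
    have "r = r \<otimes>\<^bsub>K\<^esub> (s \<oplus>\<^bsub>K\<^esub> t \<otimes>\<^bsub>K\<^esub> z)" using st(3) rK by simp
    also have "\<dots> = r \<otimes>\<^bsub>K\<^esub> s \<oplus>\<^bsub>K\<^esub> (r \<otimes>\<^bsub>K\<^esub> z) \<otimes>\<^bsub>K\<^esub> t"
      using rK cK z by (simp add: K.r_distr K.m_ac)
    finally have "r = r \<otimes>\<^bsub>K\<^esub> s \<oplus>\<^bsub>K\<^esub> (r \<otimes>\<^bsub>K\<^esub> z) \<otimes>\<^bsub>K\<^esub> t" .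
    moreover have "s \<in> Idl\<^bsub>R\<^esub> {s, t}" "t \<in> Idl\<^bsub>R\<^esub> {s, t}" using R.genideal_self[OF c] by auto
    ultimately show "r \<in> Idl\<^bsub>R\<^esub> {s, t}" using Ii(3)[OF Ii(4)[OF r(1)] Ii(4)[OF r(2)]] by metis
  qed
  moreover have "Idl\<^bsub>R\<^esub> {s, t} \<subseteq> conductor R K z"
    using st by (intro R.genideal_minimal[OF conductor_ideal[OF z]]) auto
  ultimately have "conductor R K z = Idl\<^bsub>R\<^esub> {s, t}" by blast
  then show ?thesis using c unfolding fin_gen_ideal_def by blast
qed

text \<open>Put \<open>z = a / b\<close>, so that \<open>s a = (s z) b\<close> and
  \<open>t a = (t z) b\<close>. Since \<open>s + t z = 1\<close>, one of \<open>s\<close> and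
  \<open>t z\<close> lies outside \<open>M\<close>: the former makes \<open>b\<close> divide
  \<open>a\<close>, the latter makes \<open>a\<close> divide \<open>b\<close>.\<close>

lemma locally_divides_total:
  assumes M: "maximalideal M R" and a: "a \<in> carrier R" and b: "b \<in> carrier R"
  shows "locally_divides R M a b \<or> locally_divides R M b a"
proof (cases "b = \<zero>\<^bsub>K\<^esub>")
  case True
  then have "\<one>\<^bsub>K\<^esub> \<otimes>\<^bsub>K\<^esub> b = \<zero>\<^bsub>K\<^esub> \<otimes>\<^bsub>K\<^esub> a" using a by (simp add: R_sub)
  then have "locally_divides R M a b"
    unfolding locally_divides_def using maximal_K(2)[OF M] R_mult R_closed(4,5) by (metis DiffI)
  then show ?thesis ..
next
  case False
  note inv = K_inv[OF R_sub[OF b] False]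
  define z where "z = a \<otimes>\<^bsub>K\<^esub> inv\<^bsub>K\<^esub> b"
  have z: "z \<in> carrier K" using a inv by (simp add: z_def R_sub)
  have bz: "b \<otimes>\<^bsub>K\<^esub> z = a" using a b inv by (simp add: z_def R_sub K.m_lcomm)
  obtain s t where st: "s \<in> conductor R K z" "t \<in> conductor R K z"
    "s \<oplus>\<^bsub>K\<^esub> t \<otimes>\<^bsub>K\<^esub> z = \<one>\<^bsub>K\<^esub>" by (rule exists_conductor_generators[OF z])
  then have R: "s \<in> carrier R" "t \<in> carrier R" "s \<otimes>\<^bsub>K\<^esub> z \<in> carrier R" "t \<otimes>\<^bsub>K\<^esub> z \<in> carrier R"
    by (auto simp: conductor_def)
  have eq: "w \<otimes>\<^bsub>K\<^esub> a = (w \<otimes>\<^bsub>K\<^esub> z) \<otimes>\<^bsub>K\<^esub> b" if "w \<in> carrier R" for w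
    unfolding bz[symmetric] using that b z by (simp add: R_sub K.m_ac)
  show ?thesis
  proof (cases "s \<in> M")
    case False
    then have "locally_divides R M b a"
      using R eq[OF R(1)] by (auto simp: locally_divides_def R_ops)
    then show ?thesis ..
  next
    case True
    then have "t \<otimes>\<^bsub>K\<^esub> z \<notin> M" using st(3) ideal_K(3)[OF maximal_K(1)[OF M]] maximal_K(2)[OF M] by metis
    then have "locally_divides R M a b"
      using R eq[OF R(2), symmetric] by (auto simp: locally_divides_def R_ops)
    then show ?thesis ..
  qed
qed

end

section \<open>Sharpness, divisoriality and the transforms at a nonzero maximal ideal\<close>

locale prufer_maximal = prufer_domain +
  fixes M
  assumes maximal: "maximalideal M R" and nonzero: "M \<noteq> {\<zero>\<^bsub>R\<^esub>}"

sublocale prufer_maximal \<subseteq> locally_valuation R M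
  by (intro locally_valuation.intro locally_valuation_axioms.intro R.domain_axioms
      maximal nonzero locally_divides_total)

context prufer_maximal
begin

lemma M_proper: "M \<noteq> carrier R"
  using M_one R.one_closed by blast

lemma fin_gen_imp_divisorial:
  "fin_gen_ideal R I \<Longrightarrow> I \<noteq> {\<zero>\<^bsub>R\<^esub>} \<Longrightarrow> divisorial R K I"
  by (rule invertible_imp_divisorial[OF fin_gen_invertible])

lemma invertible_iff_fin_gen: "invertible_ideal R K M \<longleftrightarrow> fin_gen_ideal R M"
  using invertible_imp_fin_gen fin_gen_invertible[OF _ nonzero] by blast

text \<open>An element of the inverse outside \<open>R\<close> has a proper conductor containing
  \<open>M\<close>. By maximality this conductor is \<open>M\<close>, which is therefore finitely
  generated.\<close>

lemma invertible_iff_colon: "carrier R \<subset> colon_inv R K M \<longleftrightarrow> invertible_ideal R K M"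
proof
  assume "carrier R \<subset> colon_inv R K M"
  then obtain z where "z \<in> colon_inv R K M" and zR: "z \<notin> carrier R" by auto
  then have z: "z \<in> carrier K" "M \<subseteq> conductor R K z" using mem_colon_inv[of M z] M_carr by auto
  have "conductor R K z \<noteq> carrier R" using conductor_eq_carrier[OF z(1)] zR by simp
  then have "conductor R K z = M"
    using maximalideal_properties(4)[OF maximal conductor_ideal[OF z(1)] z(2)] by blast
  then show "invertible_ideal R K M" using conductor_fin_gen[OF z(1)] invertible_iff_fin_gen by simp
next
  assume "invertible_ideal R K M"
  then show "carrier R \<subset> colon_inv R K M"
    using invertible_colon_inv M_proper carrier_subset_colon_inv[of M] M_carr by auto
qed

lemma divisorial_iff_invertible: "divisorial R K M \<longleftrightarrow> invertible_ideal R K M"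
proof
  assume "divisorial R K M"
  then have "colon_inv R K M \<noteq> carrier R" using divisorial_proper_colon_inv M_proper by blast
  then have "carrier R \<subset> colon_inv R K M" using carrier_subset_colon_inv[of M] M_carr by auto
  then show "invertible_ideal R K M" using invertible_iff_colon by blast
qed (rule invertible_imp_divisorial[OF _ nonzero])

text \<open>If \<open>M\<close> equals its square, the inverse of \<open>M\<close> maps
  \<open>M\<close> into \<open>M\<close>, because \<open>w (i j) = (w i) j\<close>. An element
  \<open>w\<close> of the inverse outside \<open>R\<close> has conductor \<open>M\<close>, so
  \<open>s\<close>, \<open>t\<close> and \<open>t w\<close> all lie in \<open>M\<close>, and with
  them \<open>s + t w = 1\<close>. Hence the inverse is \<open>R\<close>, which a divisorial
  \<open>M\<close> excludes.\<close>

lemma divisorial_imp_not_idempotent: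
  assumes "divisorial R K M" shows "\<not> idempotent_ideal R M"
proof
  assume "idempotent_ideal R M"
  then have sq: "M \<cdot>\<^bsub>R\<^esub> M = M" unfolding idempotent_ideal_def by (rule sym)
  have "colon_inv R K M \<subseteq> carrier R"
  proof
    fix w assume "w \<in> colon_inv R K M"
    then have w: "w \<in> carrier K" "\<And>x. x \<in> M \<Longrightarrow> w \<otimes>\<^bsub>K\<^esub> x \<in> carrier R" by (auto simp: colon_inv_def)
    have wM: "x \<in> carrier R \<and> w \<otimes>\<^bsub>K\<^esub> x \<in> M" if "x \<in> M \<cdot>\<^bsub>R\<^esub> M" for x
      using that
    proof (induction x rule: ideal_prod.induct)
      case (prod i j)
      have ij: "i \<in> carrier R" "j \<in> carrier R" using prod M_carr by auto
      then have "w \<otimes>\<^bsub>K\<^esub> (i \<otimes>\<^bsub>K\<^esub> j) = (w \<otimes>\<^bsub>K\<^esub> i) \<otimes>\<^bsub>K\<^esub> j" using w(1) by (simp add: K.m_assoc R_sub)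
      then show ?case using ideal_K(4)[OF M_ideal w(2)[OF prod(1)] prod(2)] ij by (simp add: R_ops)
    next
      case (sum x y)
      then have "w \<otimes>\<^bsub>K\<^esub> (x \<oplus>\<^bsub>K\<^esub> y) = w \<otimes>\<^bsub>K\<^esub> x \<oplus>\<^bsub>K\<^esub> w \<otimes>\<^bsub>K\<^esub> y" using w(1) by (simp add: K.r_distr R_sub)
      then show ?case using sum ideal_K(3)[OF M_ideal] by (simp add: R_ops)
    qed
    show "w \<in> carrier R"
    proof (rule ccontr)
      assume wR: "w \<notin> carrier R"
      obtain s t where st: "s \<in> conductor R K w" "t \<in> conductor R K w"
        "s \<oplus>\<^bsub>K\<^esub> t \<otimes>\<^bsub>K\<^esub> w = \<one>\<^bsub>K\<^esub>" by (rule exists_conductor_generators[OF w(1)])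
      have MC: "M \<subseteq> conductor R K w" using w M_carr mem_conductor[OF w(1)] by auto
      have "conductor R K w \<noteq> carrier R" using conductor_eq_carrier[OF w(1)] wR by simp
      then have "conductor R K w = M"
        using maximalideal_properties(4)[OF maximal conductor_ideal[OF w(1)] MC] by blast
      then have s: "s \<in> M" and t: "t \<in> M" using st by auto
      have "t \<in> M \<cdot>\<^bsub>R\<^esub> M" using t sq by simp
      then have "t \<otimes>\<^bsub>K\<^esub> w \<in> M" using wM[of t] K.m_comm[OF w(1), of t] R_sub[OF M_carr[OF t]] by auto
      then show False using ideal_K(3)[OF M_ideal s] st(3) M_one by (metis R_one)
    qed
  qed
  then show False using assms divisorial_iff_invertible invertible_iff_colon by blast
qed

text \<open>The implications run in a circle: sharp, finitely generated, divisorial, sharp. The last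
  one takes an element of the inverse of \<open>I\<close> outside \<open>R\<close>; its conductor is
  proper and contains \<open>I\<close>, so it lies in \<open>M\<close> only.\<close>

lemma sharp_iff_fin_gen:
  "sharp_prime R K M \<longleftrightarrow> (\<exists>I. fin_gen_ideal R I \<and> in_no_other_maximal R M I)"
  and sharp_iff_divisorial:
  "sharp_prime R K M \<longleftrightarrow> (\<exists>I. divisorial R K I \<and> in_no_other_maximal R M I)"
proof -
  let ?F = "\<exists>I. fin_gen_ideal R I \<and> in_no_other_maximal R M I"
  let ?D = "\<exists>I. divisorial R K I \<and> in_no_other_maximal R M I"
  have "sharp_prime R K M \<Longrightarrow> ?F"
    using mem_sharp[OF maximal nonzero] conductor_fin_gen by blast
  moreover have "?F \<Longrightarrow> ?D"
  proof -
    assume ?F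
    then obtain I where I: "fin_gen_ideal R I" "in_no_other_maximal R M I" by blast
    \<comment> \<open>The zero ideal is finitely generated and, in a local ring, lies in no other
      maximal ideal, but it is not divisorial; a nonzero element of \<open>M\<close> is adjoined to
      avoid it.\<close>
    obtain m where m: "m \<in> M" "m \<noteq> \<zero>\<^bsub>R\<^esub>" using exists_nonzero by auto
    obtain J where J: "fin_gen_ideal R J" "I \<subseteq> J" "m \<in> J" "J \<subseteq> M"
      using R.fin_gen_ideal_insert[OF I(1) M_carr[OF m(1)]] I(2) m(1) M_ideal
      unfolding in_no_other_maximal_def by metis
    have "divisorial R K J" using fin_gen_imp_divisorial[OF J(1)] J(3) m(2) by blast
    moreover have "in_no_other_maximal R M J"
      using I(2) J(2,4) unfolding in_no_other_maximal_def by blast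
    ultimately show ?D by blast
  qed
  moreover have "?D \<Longrightarrow> sharp_prime R K M"
  proof -
    assume ?D
    then obtain I where I: "divisorial R K I" "in_no_other_maximal R M I" by blast
    then have IM: "I \<subseteq> M" by (simp add: in_no_other_maximal_def)
    then have "I \<noteq> carrier R" using M_one by auto
    then have "colon_inv R K I \<noteq> carrier R" using divisorial_proper_colon_inv I by blast
    moreover have IR: "I \<subseteq> carrier R" using IM M_carr by blast
    ultimately obtain z where "z \<in> colon_inv R K I" and zR: "z \<notin> carrier R"
      using carrier_subset_colon_inv by blast
    then have z: "z \<in> carrier K" "I \<subseteq> conductor R K z" using mem_colon_inv[OF IR] by auto
    obtain N where N: "maximalideal N R" "conductor R K z \<subseteq> N"
      using conductor_proper_maximal[OF z(1) zR] .
    have "in_no_other_maximal R M (conductor R K z)"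
      using I(2) z(2) N unfolding in_no_other_maximal_def by blast
    then show ?thesis using mem_sharp[OF maximal nonzero] z(1) by blast
  qed
  ultimately show "sharp_prime R K M \<longleftrightarrow> ?F" "sharp_prime R K M \<longleftrightarrow> ?D" by blast+
qed

lemma only_self: "in_no_other_maximal R M M"
  unfolding in_no_other_maximal_def using maximalideal_subset_eq[OF maximal] by auto

text \<open>For \<open>P\<close> inside \<open>M\<close> the localization at \<open>M\<close> lies
  in the one at \<open>P\<close>. The transforms compare as needed because every maximal ideal other
  than \<open>M\<close> fails to contain \<open>P\<close>, so a failed containment at
  \<open>P\<close> also fails at \<open>M\<close>.\<close>

lemma sharp_iff_sharp_prime:
  "sharp_prime R K M \<longleftrightarrow> (\<exists>P. sharp_prime R K P \<and> in_no_other_maximal R M P)"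
proof
  assume "sharp_prime R K M"
  then show "\<exists>P. sharp_prime R K P \<and> in_no_other_maximal R M P" using only_self by auto
next
  assume "\<exists>P. sharp_prime R K P \<and> in_no_other_maximal R M P"
  then obtain P where P: "sharp_prime R K P" "in_no_other_maximal R M P" by blast
  have PM: "P \<subseteq> M" using P(2) by (simp add: in_no_other_maximal_def)
  have "carrier (loc_at R K M) \<subseteq> carrier (loc_at R K P)" using PM by (auto simp: loc_at_def)
  moreover have "Theta_transform R K P \<subseteq> Theta_transform R K M"
    using P(2) unfolding Theta_transform_def in_no_other_maximal_def by blast
  ultimately show "sharp_prime R K M"
    using P(1) M_primeideal nonzero unfolding sharp_prime_def by blast
qed

lemma carrier_subset_Omega: "carrier R \<subseteq> Omega_transform R K M"
  using subset_trans[OF carrier_subset_transform transform_subset_Omega[OF M_ideal]] .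

text \<open>\<open>R\<close> is the intersection of \<open>Theta_transform R K M\<close> with the
  localization at \<open>M\<close>, so the transform lies in the localization only when it is
  \<open>R\<close>.\<close>

lemma sharp_iff_Theta: "sharp_prime R K M \<longleftrightarrow> carrier R \<subset> Theta_transform R K M"
proof -
  have "carrier R \<subseteq> Theta_transform R K M"
    using subset_trans[OF carrier_subset_Omega Omega_subset_Theta[OF M_ideal]] .
  moreover have "sharp_prime R K M \<longleftrightarrow> \<not> Theta_transform R K M \<subseteq> carrier R"
  proof
    assume "sharp_prime R K M"
    then show "\<not> Theta_transform R K M \<subseteq> carrier R"
      using carrier_subset_loc_at[OF maximal] by (auto simp: sharp_prime_def)
  next
    assume "\<not> Theta_transform R K M \<subseteq> carrier R"
    then obtain z where z: "z \<in> Theta_transform R K M" "z \<notin> carrier R" by auto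
    then have zK: "z \<in> carrier K" by (simp add: mem_Theta)
    obtain N where N: "maximalideal N R" "conductor R K z \<subseteq> N"
      using conductor_proper_maximal[OF zK z(2)] .
    then have "M \<subseteq> N" using z(1) by (simp add: mem_Theta)
    then have "N = M" by (rule maximalideal_subset_eq[OF maximal N(1)])
    then have "z \<notin> carrier (loc_at R K M)" using mem_loc_at_iff_conductor[OF maximal zK] N(2) by blast
    then show "sharp_prime R K M" using z(1) M_primeideal nonzero by (auto simp: sharp_prime_def)
  qed
  ultimately show ?thesis by blast
qed

lemma divisorial_imp_sharp: "divisorial R K M \<Longrightarrow> sharp_prime R K M"
  using sharp_iff_divisorial only_self by auto

lemma sharp_not_idempotent_imp_divisorial:
  "sharp_prime R K M \<Longrightarrow> \<not> idempotent_ideal R M \<Longrightarrow> divisorial R K M"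
  using sharp_iff_fin_gen not_idempotent_imp_fin_gen divisorial_iff_invertible
    invertible_iff_fin_gen by auto

lemma locally_principal_iff_not_idempotent: "locally_principal R K M \<longleftrightarrow> \<not> idempotent_ideal R M"
  using locally_principal_iff[OF maximal] not_idempotent_iff by simp

lemma radical_nonzero:
  assumes "M = ideal_radical R J" shows "J \<noteq> {\<zero>\<^bsub>R\<^esub>}"
proof
  assume "J = {\<zero>\<^bsub>R\<^esub>}"
  then have "M \<subseteq> {\<zero>\<^bsub>R\<^esub>}"
    using R.ideal_radical_subset_prime[OF R.zeroprimeideal, of J] assms by auto
  then show False using exists_nonzero by auto
qed

lemma sharp_branched_iff_radical:
  "(\<exists>I. fin_gen_ideal R I \<and> M = ideal_radical R I) \<longleftrightarrow> sharp_prime R K M \<and> branched R M"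
proof
  assume "\<exists>I. fin_gen_ideal R I \<and> M = ideal_radical R I"
  then obtain I where I: "fin_gen_ideal R I" "M = ideal_radical R I" by blast
  note Ii = R.fin_gen_ideal_is_ideal[OF I(1)]
  have "sharp_prime R K M"
    using R.only_maximal_if_radical[OF maximal I(2)[symmetric] Ii] I(1) sharp_iff_fin_gen by blast
  moreover have "branched R M"
  \<comment> \<open>An \<open>I\<close> different from \<open>M\<close> is itself a proper primary
    ideal; if \<open>I = M\<close>, the square of \<open>M\<close> takes its place.\<close>
  proof (cases "I = M")
    case True
    then have "\<not> idempotent_ideal R M"
      using I(1) divisorial_imp_not_idempotent divisorial_iff_invertible invertible_iff_fin_gen by simp
    then show ?thesis by (rule not_idempotent_imp_branched)
  next
    case False
    then show ?thesis
      using R.primary_to_if_radical_maximal[OF maximal Ii I(2)[symmetric]]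
      by (auto simp: branched_def proper_primary_to_def)
  qed
  ultimately show "sharp_prime R K M \<and> branched R M" ..
next
  assume "sharp_prime R K M \<and> branched R M"
  then show "\<exists>I. fin_gen_ideal R I \<and> M = ideal_radical R I"
    using sharp_iff_fin_gen branched_imp_radical_fin_gen by metis
qed

lemma primary_divisorial_imp_sharp:
  assumes "primary_to R M Q" "divisorial R K Q" shows "sharp_prime R K M"
proof -
  have "in_no_other_maximal R M Q"
    using R.only_maximal_if_radical[OF maximal _ primary_to_ideal[OF assms(1)]] assms(1)
    by (simp add: primary_to_def)
  then show ?thesis using sharp_iff_divisorial assms(2) by blast
qed

lemma sharp_branched_iff_proper_divisorial:
  "(\<exists>Q. proper_primary_to R M Q \<and> divisorial R K Q) \<longleftrightarrow> sharp_prime R K M \<and> branched R M"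
proof
  assume "\<exists>Q. proper_primary_to R M Q \<and> divisorial R K Q"
  then show "sharp_prime R K M \<and> branched R M"
    using primary_divisorial_imp_sharp by (auto simp: branched_def proper_primary_to_def)
next
  assume SB: "sharp_prime R K M \<and> branched R M"
  then obtain J where J: "fin_gen_ideal R J" "M = ideal_radical R J"
    using sharp_branched_iff_radical by blast
  show "\<exists>Q. proper_primary_to R M Q \<and> divisorial R K Q"
  proof (cases "J = M")
    case False
    then have "proper_primary_to R M J"
      using R.primary_to_if_radical_maximal[OF maximal R.fin_gen_ideal_is_ideal[OF J(1)] J(2)[symmetric]]
      by (simp add: proper_primary_to_def)
    then show ?thesis using fin_gen_imp_divisorial[OF J(1) radical_nonzero[OF J(2)]] by blast
  next
    case True
    then have fg: "fin_gen_ideal R M" using J by simp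
    \<comment> \<open>As \<open>M\<close> does not count as proper, its square is the witness. The
      square is nonzero because its radical is \<open>M\<close>.\<close>
    have "M = ideal_radical R (M \<cdot>\<^bsub>R\<^esub> M)" using square_primary by (simp add: primary_to_def)
    then have "divisorial R K (M \<cdot>\<^bsub>R\<^esub> M)"
      using fin_gen_imp_divisorial[OF R.fin_gen_ideal_prod[OF fg fg] radical_nonzero] by blast
    moreover have "M \<cdot>\<^bsub>R\<^esub> M \<noteq> M"
      using fg divisorial_imp_not_idempotent divisorial_iff_invertible invertible_iff_fin_gen
      by (auto simp: idempotent_ideal_def)
    ultimately show ?thesis using square_primary by (auto simp: proper_primary_to_def)
  qed
qed

lemma sharp_branched_iff_primary_divisorial:
  "(\<exists>Q. primary_to R M Q \<and> divisorial R K Q) \<longleftrightarrow> sharp_prime R K M \<and> branched R M"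
proof
  assume "\<exists>Q. primary_to R M Q \<and> divisorial R K Q"
  then obtain Q where Q: "primary_to R M Q" "divisorial R K Q" by blast
  have "branched R M"
  proof (cases "Q = M")
    case True
    then show ?thesis
      using Q(2) divisorial_imp_not_idempotent not_idempotent_imp_branched by blast
  next
    case False
    then show ?thesis using Q(1) by (auto simp: branched_def proper_primary_to_def)
  qed
  then show "sharp_prime R K M \<and> branched R M" using primary_divisorial_imp_sharp[OF Q] by blast
qed (use sharp_branched_iff_proper_divisorial in \<open>auto simp: proper_primary_to_def\<close>)

text \<open>Both sides are compared with \<open>M\<close> being the radical of a finitely generated
  \<open>J\<close>. An element of the inverse of \<open>J\<close> outside \<open>R\<close> has a
  conductor above \<open>J\<close>, so it lies in the transform; conversely, the conductor of an
  element of the transform outside \<open>R\<close> can be taken as \<open>J\<close>.\<close>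

lemma Omega_iff: "carrier R \<subset> Omega_transform R K M \<longleftrightarrow> sharp_prime R K M \<and> branched R M"
proof -
  have MR: "M \<subseteq> carrier R" using M_carr by auto
  have "(\<exists>I. fin_gen_ideal R I \<and> M = ideal_radical R I) \<longleftrightarrow> \<not> Omega_transform R K M \<subseteq> carrier R"
  proof
    assume "\<exists>I. fin_gen_ideal R I \<and> M = ideal_radical R I"
    then obtain J where J: "fin_gen_ideal R J" "M = ideal_radical R J" by blast
    have JM: "J \<subseteq> M" using R.subset_ideal_radical[OF R.fin_gen_ideal_is_ideal[OF J(1)]] J(2) by simp
    then have JR: "J \<subseteq> carrier R" "J \<noteq> carrier R" using MR M_one by auto
    have "colon_inv R K J \<noteq> carrier R"
      using divisorial_proper_colon_inv[OF fin_gen_imp_divisorial[OF J(1) radical_nonzero[OF J(2)]] JR(2)] .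
    then obtain z where "z \<in> colon_inv R K J" and zR: "z \<notin> carrier R"
      using carrier_subset_colon_inv[OF JR(1)] by blast
    then have z: "z \<in> carrier K" "J \<subseteq> conductor R K z" using mem_colon_inv[OF JR(1)] by auto
    then have "z \<in> Omega_transform R K M"
      using mem_Omega[OF MR] R.ideal_radical_mono[OF z(2)] J(2) by simp
    then show "\<not> Omega_transform R K M \<subseteq> carrier R" using zR by blast
  next
    assume "\<not> Omega_transform R K M \<subseteq> carrier R"
    then obtain z where z: "z \<in> carrier K" "M \<subseteq> ideal_radical R (conductor R K z)" "z \<notin> carrier R"
      using mem_Omega[OF MR] by blast
    obtain N where N: "maximalideal N R" "conductor R K z \<subseteq> N"
      using conductor_proper_maximal[OF z(1,3)] .
    have rN: "ideal_radical R (conductor R K z) \<subseteq> N"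
      using R.ideal_radical_subset_prime[OF R.maximalideal_prime[OF N(1)] N(2)] .
    then have "M \<subseteq> N" using z(2) by blast
    then have "N = M" by (rule maximalideal_subset_eq[OF maximal N(1)])
    then have "M = ideal_radical R (conductor R K z)" using z(2) rN by blast
    then show "\<exists>I. fin_gen_ideal R I \<and> M = ideal_radical R I" using conductor_fin_gen[OF z(1)] by blast
  qed
  moreover have "carrier R \<subseteq> Omega_transform R K M"
    by (rule carrier_subset_Omega)
  ultimately show ?thesis using sharp_branched_iff_radical by blast
qed

text \<open>All positive powers are \<open>M\<close>, so each term of the union is an inverse of
  \<open>M\<close> or, for exponent 0, of \<open>R\<close>.\<close>

lemma idempotent_transform:
  assumes I: "idempotent_ideal R M" and C: "colon_inv R K M = carrier R"
  shows "ideal_transform R K M = carrier R"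
proof -
  have "ideal_power R M (Suc n) = M" for n
  proof (induction n)
    case 0
    then show ?case using R.ideal_prod_one[OF M_ideal] R.ideal_prod_commute[OF M_ideal R.oneideal] by simp
  next
    case (Suc n)
    then show ?case using I[unfolded idempotent_ideal_def, symmetric] by simp
  qed
  then have "colon_inv R K (ideal_power R M n) = carrier R" for n
    using C colon_inv_carrier by (cases n) (simp_all del: ideal_power.simps(2))
  then show ?thesis by (simp add: ideal_transform_def)
qed

end

theorem theorem3p1:
  fixes R K :: "('a, 'b) ring_scheme" and M :: "'a set"
  assumes "prufer_domain R K"
    and "carrier R \<noteq> carrier K"
    and "maximalideal M R"
    and "M \<noteq> {\<zero>\<^bsub>R\<^esub>}"
  shows
    "(Lambda_tuple R K M \<in>
     {(True, True, True, False),
      (True, False, True, True),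
      (True, False, False, True),
      (False, False, True, True),
      (False, False, True, False),
      (False, False, False, True)}) \<and>
    ((Lambda_tuple R K M = (True, True, True, False) \<longleftrightarrow> carrier R \<subset> colon_inv R K M) \<and>
     (carrier R \<subset> colon_inv R K M \<longleftrightarrow> invertible_ideal R K M)) \<and>
    ((Lambda_tuple R K M = (True, False, True, True) \<longleftrightarrow>
        \<not> fin_gen_ideal R M \<and>
          (\<exists>I. fin_gen_ideal R I \<and> M = ideal_radical R I)) \<and>
     (Lambda_tuple R K M = (True, False, True, True) \<longleftrightarrow>
        \<not> locally_principal R K M \<and>
          (\<exists>I. fin_gen_ideal R I \<and> M = ideal_radical R I)) \<and>
     (Lambda_tuple R K M = (True, False, True, True) \<longleftrightarrow>
        \<not> invertible_ideal R K M \<and>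
          (\<exists>Q. proper_primary_to R M Q \<and> divisorial R K Q)) \<and>
     (Lambda_tuple R K M = (True, False, True, True) \<longrightarrow>
        carrier R = colon_inv R K M \<and> colon_inv R K M = ideal_transform R K M \<and>
          ideal_transform R K M \<subset> Omega_transform R K M \<and> Omega_transform R K M \<subseteq> Theta_transform R K M)) \<and>
    ((Lambda_tuple R K M = (True, False, False, True) \<longleftrightarrow>
        M = \<Union>{P. P \<subset> M \<and> primeideal P R} \<and>
          carrier R \<subset> Theta_transform R K M) \<and>
     (Lambda_tuple R K M = (True, False, False, True) \<longleftrightarrow>
        \<not> (\<exists>Q. proper_primary_to R M Q) \<and>
          (\<exists>I. divisorial R K I \<and> in_no_other_maximal R M I)) \<and>
     (Lambda_tuple R K M = (True, False, False, True) \<longleftrightarrow>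
        \<not> (\<exists>Q. proper_primary_to R M Q) \<and>
          (\<exists>I. fin_gen_ideal R I \<and> in_no_other_maximal R M I)) \<and>
     (Lambda_tuple R K M = (True, False, False, True) \<longleftrightarrow>
        \<not> (\<exists>Q. proper_primary_to R M Q) \<and>
          (\<exists>P. sharp_prime R K P \<and> in_no_other_maximal R M P)) \<and>
     (Lambda_tuple R K M = (True, False, False, True) \<longrightarrow>
        carrier R = colon_inv R K M \<and> colon_inv R K M = ideal_transform R K M \<and>
          ideal_transform R K M = Omega_transform R K M \<and> Omega_transform R K M \<subset> Theta_transform R K M)) \<and>
    ((Lambda_tuple R K M = (False, False, True, True) \<longleftrightarrow>
        (\<exists>I. fin_gen_ideal R I \<and> minimal_prime_over R M I) \<and>
          \<not> (\<exists>I. fin_gen_ideal R I \<and> M = ideal_radical R I) \<and> \<not> locally_principal R K M) \<and>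
     (Lambda_tuple R K M = (False, False, True, True) \<longleftrightarrow>
        (\<exists>Q. proper_primary_to R M Q) \<and>
          \<not> (\<exists>Q. proper_primary_to R M Q \<and> divisorial R K Q) \<and>
          \<not> locally_principal R K M) \<and>
     (Lambda_tuple R K M = (False, False, True, True) \<longleftrightarrow>
        (\<exists>I. ideal I R \<and> I \<subset> M \<and> M = ideal_radical R I) \<and>
          \<not> (\<exists>Q. primary_to R M Q \<and> divisorial R K Q) \<and>
          \<not> locally_principal R K M) \<and>
     (Lambda_tuple R K M = (False, False, True, True) \<longrightarrow>
        carrier R = colon_inv R K M \<and> colon_inv R K M = ideal_transform R K M \<and>
          ideal_transform R K M = Omega_transform R K M \<and> Omega_transform R K M = Theta_transform R K M)) \<and>
    ((Lambda_tuple R K M = (False, False, True, False) \<longleftrightarrow>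
        locally_principal R K M \<and>
          \<not> (\<exists>I. fin_gen_ideal R I \<and> M = ideal_radical R I)) \<and>
     (Lambda_tuple R K M = (False, False, True, False) \<longleftrightarrow>
        locally_principal R K M \<and>
          \<not> (\<exists>Q. proper_primary_to R M Q \<and> divisorial R K Q)) \<and>
     (Lambda_tuple R K M = (False, False, True, False) \<longleftrightarrow>
        (\<exists>I. ideal I R \<and> I \<subset> M \<and> M = ideal_radical R I) \<and>
          \<not> (\<exists>Q. primary_to R M Q \<and> divisorial R K Q) \<and>
          locally_principal R K M) \<and>
     (Lambda_tuple R K M = (False, False, True, False) \<longrightarrow>
        carrier R = colon_inv R K M \<and> colon_inv R K M = ideal_transform R K M \<and>
          ideal_transform R K M = Omega_transform R K M \<and> Omega_transform R K M = Theta_transform R K M)) \<and>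
    ((Lambda_tuple R K M = (False, False, False, True) \<longleftrightarrow>
        M = \<Union>{P. P \<subset> M \<and> primeideal P R} \<and>
          carrier R = Theta_transform R K M) \<and>
     (Lambda_tuple R K M = (False, False, False, True) \<longleftrightarrow>
        \<not> (\<exists>Q. proper_primary_to R M Q) \<and>
          (\<forall>I. fin_gen_ideal R I \<and> I \<subseteq> M \<longrightarrow>
            (\<exists>N. maximalideal N R \<and> N \<noteq> M \<and> I \<subseteq> N))) \<and>
     (Lambda_tuple R K M = (False, False, False, True) \<longleftrightarrow>
        \<not> (\<exists>Q. proper_primary_to R M Q) \<and>
          (\<forall>I. divisorial R K I \<and> I \<subseteq> M \<longrightarrow>
            (\<exists>N. maximalideal N R \<and> N \<noteq> M \<and> I \<subseteq> N))) \<and>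
     (Lambda_tuple R K M = (False, False, False, True) \<longrightarrow>
        carrier R = colon_inv R K M \<and> colon_inv R K M = ideal_transform R K M \<and>
          ideal_transform R K M = Omega_transform R K M \<and> Omega_transform R K M = Theta_transform R K M))"
proof -
  interpret prufer_maximal R K M
    using assms by (intro prufer_maximal.intro prufer_maximal_axioms.intro)
  let ?S = "sharp_prime R K M" and ?D = "divisorial R K M" and ?B = "branched R M"
    and ?I = "idempotent_ideal R M"
  \<comment> \<open>These three implications leave exactly six of the sixteen truth
    assignments.\<close>
  have rel: "?D \<longrightarrow> ?S \<and> \<not> ?I" "?S \<and> \<not> ?I \<longrightarrow> ?D" "\<not> ?I \<longrightarrow> ?B"
    using divisorial_imp_sharp divisorial_imp_not_idempotent
      sharp_not_idempotent_imp_divisorial not_idempotent_imp_branched by simp_all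
  have tuple: "Lambda_tuple R K M = (a, b, c, d) \<longleftrightarrow> (?S = a \<and> ?D = b \<and> ?B = c \<and> ?I = d)"
    for a b c d by (simp add: Lambda_tuple_def)
  have inv: "carrier R \<subset> colon_inv R K M \<longleftrightarrow> ?D" "invertible_ideal R K M \<longleftrightarrow> ?D"
      "fin_gen_ideal R M \<longleftrightarrow> ?D"
    by (simp_all only: invertible_iff_colon divisorial_iff_invertible invertible_iff_fin_gen)
  have branched: "(\<exists>Q. proper_primary_to R M Q) \<longleftrightarrow> ?B" by (simp add: branched_def)
  have sub: "carrier R \<subseteq> Theta_transform R K M"
    by (rule subset_trans[OF carrier_subset_Omega Omega_subset_Theta[OF M_ideal]])
  have Theta: "carrier R \<subset> Theta_transform R K M \<longleftrightarrow> ?S" by (rule sharp_iff_Theta[symmetric])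
  have Theta': "carrier R = Theta_transform R K M \<longleftrightarrow> \<not> ?S"
    unfolding sharp_iff_Theta psubset_eq using sub by (simp only: simp_thms)
  have no_sharp:
    "(\<forall>I. fin_gen_ideal R I \<and> I \<subseteq> M \<longrightarrow> (\<exists>N. maximalideal N R \<and> N \<noteq> M \<and> I \<subseteq> N)) \<longleftrightarrow> \<not> ?S"
    unfolding sharp_iff_fin_gen in_no_other_maximal_def by metis
  have no_sharp':
    "(\<forall>I. divisorial R K I \<and> I \<subseteq> M \<longrightarrow> (\<exists>N. maximalideal N R \<and> N \<noteq> M \<and> I \<subseteq> N)) \<longleftrightarrow> \<not> ?S"
    unfolding sharp_iff_divisorial in_no_other_maximal_def by metis
  have chain: "carrier R \<subseteq> ideal_transform R K M" "ideal_transform R K M \<subseteq> Omega_transform R K M"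
      "Omega_transform R K M \<subseteq> Theta_transform R K M"
    using carrier_subset_transform transform_subset_Omega[OF M_ideal] Omega_subset_Theta[OF M_ideal] .
  have colon: "carrier R = colon_inv R K M" if "\<not> ?D"
    using that inv(1) carrier_subset_colon_inv[of M] M_carr by blast
  have idem: "ideal_transform R K M = carrier R" if "\<not> ?D" ?I
    using idempotent_transform that colon by simp
  have Omega: "Omega_transform R K M = carrier R" if "\<not> (?S \<and> ?B)"
    using that Omega_iff chain by blast
  \<comment> \<open>Without sharpness the end of the chain is \<open>R\<close>, which squeezes
    everything in between; this covers idempotent and non-idempotent \<open>M\<close> alike. In the
    sharp cases the chain ends above \<open>R\<close>, and idempotence has to pin down
    \<open>ideal_transform\<close>.\<close>
  have Theta_R: "carrier R = colon_inv R K M \<and> colon_inv R K M = ideal_transform R K M \<and>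
      ideal_transform R K M = Omega_transform R K M \<and> Omega_transform R K M = Theta_transform R K M"
    if "\<not> ?S"
    using that rel(1) colon Theta' chain by blast
  have case2: "carrier R = colon_inv R K M \<and> colon_inv R K M = ideal_transform R K M \<and>
      ideal_transform R K M \<subset> Omega_transform R K M \<and> Omega_transform R K M \<subseteq> Theta_transform R K M"
    if "?S" "\<not> ?D" ?B ?I
    using that colon idem Omega_iff chain(3) by auto
  have case3: "carrier R = colon_inv R K M \<and> colon_inv R K M = ideal_transform R K M \<and>
      ideal_transform R K M = Omega_transform R K M \<and> Omega_transform R K M \<subset> Theta_transform R K M"
    if "?S" "\<not> ?D" "\<not> ?B" ?I
    using that colon idem Omega Theta by auto
  \<comment> \<open>These turn every condition in the equivalences into a Boolean combination of
    \<open>?S\<close>, \<open>?D\<close>, \<open>?B\<close> and \<open>?I\<close>, so that only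
    propositional reasoning from \<open>rel\<close> remains.\<close>
  note iffs = inv branched Theta Theta' no_sharp no_sharp' sharp_branched_iff_radical
    sharp_branched_iff_proper_divisorial sharp_branched_iff_primary_divisorial
    Union_primes_iff sharp_iff_divisorial[symmetric] sharp_iff_fin_gen[symmetric]
    sharp_iff_sharp_prime[symmetric] branched_iff_minimal_over_fin_gen[symmetric]
    branched_iff_radical[symmetric] locally_principal_iff_not_idempotent
  show ?thesis
    unfolding iffs tuple insert_iff empty_iff simp_thms
    using rel case2 case3 Theta_R by (intro conjI; argo)
qed

end
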